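(* Let $G$ be the Grigorchuk group, $[G,G]$ its commutator subgroup (of index 8 in $G$), and $\sigma$ the injective endomorphism of $G$ given by $\sigma(a)=aca$, $\sigma(c)=dc$, $\sigma(d)=c$. Let $\Delta=[G,G]*_\sigma$ be the ascending HNN extension of $[G,G]$ formed using the restriction of $\sigma$ to $[G,G]$. Then the only finite index subgroups of $\Delta$ are the cyclic covers of $\Delta$.
   Context: The Grigorchuk group $G=\langle a,c,d\rangle$ is the group of automorphisms of the infinite rooted binary tree generated by $a,b,c,d$, where $a$ swaps the two subtrees below the root and $b,c,d$ fix the first level and are defined recursively by their actions on the two subtrees as $b=(a,c)$, $c=(a,d)$, $d=(1,b)$; one has $b=cd=dc$. For a group $N=\langle X\mid R\rangle$ and an injective endomorphism $\theta:N\to N$, the ascending HNN extension $N*_\theta$ with stable letter $t$ is the group $\langle X,t\mid R,\ txt^{-1}=\theta(x)\ \forall x\in X\rangle$. Its cyclic covers are the subgroups $\langle N,t^n\rangle$ for $n\ge 1$, which are the kernels of the maps to the cyclic group $C_n$ given by the exponent sum of $t$ modulo $n$. *)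

theory Defs
  imports "HOL-Algebra.Bij" "HOL-Algebra.Generated_Groups"
begin

section \<open>The Grigorchuk group\<close>

text \<open>Vertices of the infinite rooted binary tree are finite words over \<^typ>\<open>bool\<close>; the root is the
  empty word, and the head of a nonempty word tells which of the two subtrees below the root the
  vertex lies in (\<^term>\<open>False\<close>: first, \<^term>\<open>True\<close>: second).\<close>

type_synonym vertex = "bool list"

definition tree_adj :: "vertex \<Rightarrow> vertex \<Rightarrow> bool" where
  "tree_adj v w \<longleftrightarrow> (\<exists>x. w = v @ [x]) \<or> (\<exists>x. v = w @ [x])"

definition tree_automorphisms :: "(vertex \<Rightarrow> vertex) set" where
  "tree_automorphisms =
     {f. bij f \<and> f [] = [] \<and> (\<forall>v w. tree_adj (f v) (f w) \<longleftrightarrow> tree_adj v w)}"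

definition Tree_Aut :: "(vertex \<Rightarrow> vertex) monoid" where
  "Tree_Aut = BijGroup (UNIV :: vertex set) \<lparr>carrier := tree_automorphisms\<rparr>"

fun grig_a :: "vertex \<Rightarrow> vertex" where
  "grig_a [] = []"
| "grig_a (x # w) = (\<not> x) # w"

fun grig_b :: "vertex \<Rightarrow> vertex" and grig_c :: "vertex \<Rightarrow> vertex" and grig_d :: "vertex \<Rightarrow> vertex" where
  "grig_b [] = []"
| "grig_b (False # w) = False # grig_a w"
| "grig_b (True # w) = True # grig_c w"
| "grig_c [] = []"
| "grig_c (False # w) = False # grig_a w"
| "grig_c (True # w) = True # grig_d w"
| "grig_d [] = []"
| "grig_d (False # w) = False # w"
| "grig_d (True # w) = True # grig_b w"

definition Grigorchuk :: "(vertex \<Rightarrow> vertex) monoid" where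
  "Grigorchuk = Tree_Aut \<lparr>carrier := generate Tree_Aut {grig_a, grig_b, grig_c, grig_d}\<rparr>"

definition Grigorchuk_commutator :: "(vertex \<Rightarrow> vertex) monoid" where
  "Grigorchuk_commutator = Grigorchuk \<lparr>carrier := derived Grigorchuk (carrier Grigorchuk)\<rparr>"

lemma Tree_Aut_mult:
  assumes "f \<in> tree_automorphisms" "g \<in> tree_automorphisms"
  shows "f \<otimes>\<^bsub>Tree_Aut\<^esub> g = f \<circ> g"
  using assms by (auto simp: Tree_Aut_def tree_automorphisms_def BijGroup_def Bij_def compose_def)

lemma subgroup_tree_automorphisms: "subgroup tree_automorphisms (BijGroup UNIV)"
proof (rule group.subgroupI[OF group_BijGroup])
  show "tree_automorphisms \<subseteq> carrier (BijGroup UNIV)"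
    by (auto simp: tree_automorphisms_def BijGroup_def Bij_def)
  have "id \<in> tree_automorphisms"
    by (auto simp: tree_automorphisms_def)
  then show "tree_automorphisms \<noteq> {}" by blast
next
  fix f assume f: "f \<in> tree_automorphisms"
  then have "bij f" by (simp add: tree_automorphisms_def)
  have "tree_adj (inv_into UNIV f v) (inv_into UNIV f w) \<longleftrightarrow> tree_adj v w" for v w
  proof -
    have "tree_adj (f (inv_into UNIV f v)) (f (inv_into UNIV f w))
        \<longleftrightarrow> tree_adj (inv_into UNIV f v) (inv_into UNIV f w)"
      using f unfolding tree_automorphisms_def by blast
    then show ?thesis
      using surj_f_inv_f[OF bij_is_surj[OF \<open>bij f\<close>]] by simp
  qed
  then have "inv_into UNIV f \<in> tree_automorphisms"
    using f \<open>bij f\<close> bij_imp_bij_inv[OF \<open>bij f\<close>] inv_f_f[OF bij_is_inj[OF \<open>bij f\<close>], of "[]"]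
    by (simp add: tree_automorphisms_def)
  moreover have "inv\<^bsub>BijGroup UNIV\<^esub> f = inv_into UNIV f"
    using inv_BijGroup[of f UNIV] \<open>bij f\<close> by (auto simp: Bij_def)
  ultimately show "inv\<^bsub>BijGroup UNIV\<^esub> f \<in> tree_automorphisms" by simp
next
  fix f g assume fg: "f \<in> tree_automorphisms" "g \<in> tree_automorphisms"
  then have "f \<otimes>\<^bsub>BijGroup UNIV\<^esub> g = f \<circ> g"
    using Tree_Aut_mult by (simp add: Tree_Aut_def)
  then show "f \<otimes>\<^bsub>BijGroup UNIV\<^esub> g \<in> tree_automorphisms"
    using fg by (auto simp: tree_automorphisms_def bij_comp)
qed

lemma group_Tree_Aut: "group Tree_Aut"
  unfolding Tree_Aut_def
  by (rule group.subgroup_imp_group[OF group_BijGroup subgroup_tree_automorphisms])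

lemma tree_automorphismsI:
  assumes "f \<circ> f = id" "f [] = []" "\<And>v x. \<exists>y. f (v @ [x]) = f v @ [y]"
  shows "f \<in> tree_automorphisms"
proof -
  have ff: "f (f v) = v" for v using assms(1) by (metis comp_apply id_apply)
  have *: "tree_adj (f v) (f w)" if "tree_adj v w" for v w
    using that assms(3) unfolding tree_adj_def by metis
  have "bij f" using assms(1) by (rule o_bij) (use assms(1) in simp)
  moreover have "tree_adj (f v) (f w) \<longleftrightarrow> tree_adj v w" for v w
    using *[of v w] *[of "f v" "f w"] ff by auto
  ultimately show ?thesis by (simp add: tree_automorphisms_def assms(2))
qed

lemma grig_a_invol: "grig_a (grig_a w) = w"
  by (cases w) auto

lemma grig_a_snoc: "\<exists>y. grig_a (w @ [x]) = grig_a w @ [y]"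
  by (cases w) auto

lemma grig_bcd_invol: "grig_b (grig_b w) = w" "grig_c (grig_c w) = w" "grig_d (grig_d w) = w"
  by (induction w and w and w rule: grig_b_grig_c_grig_d.induct) (auto simp: grig_a_invol)

lemma grig_bcd_snoc:
  "\<exists>y. grig_b (w @ [x]) = grig_b w @ [y]"
  "\<exists>y. grig_c (w @ [x]) = grig_c w @ [y]"
  "\<exists>y. grig_d (w @ [x]) = grig_d w @ [y]"
proof (induction w and w and w rule: grig_b_grig_c_grig_d.induct)
  case 1 show ?case by (cases x) auto
next
  case 4 show ?case by (cases x) auto
next
  case 7 show ?case by (cases x) auto
qed (use grig_a_snoc in auto)

lemma grig_gens_automorphisms: "{grig_a, grig_b, grig_c, grig_d} \<subseteq> tree_automorphisms"
  using grig_a_invol grig_a_snoc grig_bcd_invol grig_bcd_snoc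
  by (auto intro!: tree_automorphismsI)

lemma grig_cd_eq_b: "grig_c (grig_d w) = grig_b w" "grig_d (grig_c w) = grig_b w"
proof -
  have "grig_b (grig_c w) = grig_d w \<and> grig_c (grig_b w) = grig_d w
    \<and> grig_c (grig_d w) = grig_b w \<and> grig_d (grig_c w) = grig_b w
    \<and> grig_d (grig_b w) = grig_c w \<and> grig_b (grig_d w) = grig_c w"
  proof (induction w)
    case (Cons x w) then show ?case by (cases x) (auto simp: grig_a_invol)
  qed auto
  then show "grig_c (grig_d w) = grig_b w" "grig_d (grig_c w) = grig_b w" by auto
qed

lemma group_Grigorchuk: "group Grigorchuk"
  unfolding Grigorchuk_def
  using group.subgroup_imp_group[OF group_Tree_Aut]
    group.generate_is_subgroup[OF group_Tree_Aut] grig_gens_automorphisms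
  by (simp add: Tree_Aut_def)

lemma group_Grigorchuk_commutator: "group Grigorchuk_commutator"
  unfolding Grigorchuk_commutator_def
  using group.subgroup_imp_group[OF group_Grigorchuk]
    group.derived_is_subgroup[OF group_Grigorchuk] by simp

section \<open>Groups given by presentations\<close>

text \<open>In a group word, the letter \<open>(x, True)\<close> stands for the generator \<open>x\<close> and \<open>(x, False)\<close> for its
  formal inverse.\<close>

type_synonym 'x gword = "('x \<times> bool) list"

definition gwords :: "'x set \<Rightarrow> 'x gword set" where
  "gwords X = lists (X \<times> UNIV)"

inductive_set pres_rel :: "'x set \<Rightarrow> 'x gword set \<Rightarrow> ('x gword \<times> 'x gword) set"
  for X :: "'x set" and R :: "'x gword set" where
  refl: "w \<in> gwords X \<Longrightarrow> (w, w) \<in> pres_rel X R"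
| sym: "(v, w) \<in> pres_rel X R \<Longrightarrow> (w, v) \<in> pres_rel X R"
| trans: "(u, v) \<in> pres_rel X R \<Longrightarrow> (v, w) \<in> pres_rel X R \<Longrightarrow> (u, w) \<in> pres_rel X R"
| cancel: "u \<in> gwords X \<Longrightarrow> v \<in> gwords X \<Longrightarrow> x \<in> X
    \<Longrightarrow> (u @ [(x, e), (x, \<not> e)] @ v, u @ v) \<in> pres_rel X R"
| relator: "u \<in> gwords X \<Longrightarrow> v \<in> gwords X \<Longrightarrow> r \<in> R \<Longrightarrow> r \<in> gwords X
    \<Longrightarrow> (u @ r @ v, u @ v) \<in> pres_rel X R"

definition pres_class :: "'x set \<Rightarrow> 'x gword set \<Rightarrow> 'x gword \<Rightarrow> 'x gword set" where
  "pres_class X R w = pres_rel X R `` {w}"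

definition presented_group :: "'x set \<Rightarrow> 'x gword set \<Rightarrow> 'x gword set monoid" where
  "presented_group X R =
     \<lparr>carrier = gwords X // pres_rel X R,
      mult = \<lambda>A B. \<Union>u\<in>A. \<Union>v\<in>B. pres_class X R (u @ v),
      one = pres_class X R []\<rparr>"

lemma pres_rel_in_gwords: "(v, w) \<in> pres_rel X R \<Longrightarrow> v \<in> gwords X \<and> w \<in> gwords X"
  by (induction rule: pres_rel.induct) (auto simp: gwords_def)

lemma equiv_pres_rel: "equiv (gwords X) (pres_rel X R)"
proof (rule equivI)
  show "pres_rel X R \<subseteq> gwords X \<times> gwords X" using pres_rel_in_gwords by fast
  show "refl_on (gwords X) (pres_rel X R)" by (simp add: refl_on_def pres_rel.refl)
  show "sym_on UNIV (pres_rel X R)" by (rule symI) (rule pres_rel.sym)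
  show "trans_on UNIV (pres_rel X R)" by (rule transI) (rule pres_rel.trans)
qed

lemma pres_rel_ctxt:
  assumes "(v, w) \<in> pres_rel X R" "p \<in> gwords X" "q \<in> gwords X"
  shows "(p @ v @ q, p @ w @ q) \<in> pres_rel X R"
  using assms
proof (induction rule: pres_rel.induct)
  case (refl w) then show ?case by (auto intro!: pres_rel.refl simp: gwords_def)
next
  case (cancel u v x e)
  then show ?case using pres_rel.cancel[of "p @ u" X "v @ q" x e R] by (auto simp: gwords_def)
next
  case (relator u v r)
  then show ?case using pres_rel.relator[of "p @ u" X "v @ q" r R] by (auto simp: gwords_def)
next
  case (sym v w) then show ?case by (simp add: pres_rel.sym)
next
  case (trans u v w) then show ?case by (metis pres_rel.trans)
qed

lemma pres_rel_append:
  assumes "(v, v') \<in> pres_rel X R" "(w, w') \<in> pres_rel X R"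
  shows "(v @ w, v' @ w') \<in> pres_rel X R"
proof -
  have "w \<in> gwords X" "v' \<in> gwords X" "[] \<in> gwords X"
    using pres_rel_in_gwords[OF assms(1)] pres_rel_in_gwords[OF assms(2)] by (auto simp: gwords_def)
  then have "(v @ w, v' @ w) \<in> pres_rel X R" "(v' @ w, v' @ w') \<in> pres_rel X R"
    using pres_rel_ctxt[OF assms(1), of "[]" w] pres_rel_ctxt[OF assms(2), of v' "[]"] by auto
  then show ?thesis by (rule pres_rel.trans)
qed

lemma pres_class_mult:
  assumes "v \<in> gwords X" "w \<in> gwords X"
  shows "pres_class X R v \<otimes>\<^bsub>presented_group X R\<^esub> pres_class X R w = pres_class X R (v @ w)"
proof -
  have "pres_class X R (v' @ w') = pres_class X R (v @ w)"
    if "v' \<in> pres_class X R v" "w' \<in> pres_class X R w" for v' w'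
    using that pres_rel_append[of v v' X R w w'] equiv_class_eq[OF equiv_pres_rel, of "v @ w" "v' @ w'" X R]
    by (simp add: pres_class_def)
  moreover have "v \<in> pres_class X R v" "w \<in> pres_class X R w"
    using assms by (auto simp: pres_class_def intro: pres_rel.refl)
  ultimately have "(\<Union>v'\<in>pres_class X R v. \<Union>w'\<in>pres_class X R w. pres_class X R (v' @ w'))
      = pres_class X R (v @ w)" by fast
  then show ?thesis by (simp add: presented_group_def)
qed

lemma pres_inverse:
  assumes "w \<in> gwords X"
  shows "\<exists>w' \<in> gwords X. (w' @ w, []) \<in> pres_rel X R"
  using assms
proof (induction w)
  case Nil then show ?case by (intro bexI[of _ "[]"]) (auto intro: pres_rel.refl simp: gwords_def)
next
  case (Cons l w)
  obtain x e where l: "l = (x, e)" by (cases l)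
  from Cons obtain w' where w': "w' \<in> gwords X" "(w' @ w, []) \<in> pres_rel X R" by (auto simp: gwords_def)
  have "(w' @ [(x, \<not> e), (x, \<not> \<not> e)] @ w, w' @ w) \<in> pres_rel X R"
    using Cons w' by (intro pres_rel.cancel) (auto simp: gwords_def l)
  then have "((w' @ [(x, \<not> e)]) @ l # w, []) \<in> pres_rel X R"
    using w'(2) l by (auto intro: pres_rel.trans)
  moreover have "w' @ [(x, \<not> e)] \<in> gwords X" using Cons w' by (auto simp: gwords_def l)
  ultimately show ?case by blast
qed

lemma group_presented_group: "group (presented_group X R)"
proof (rule groupI)
  have car: "A \<in> carrier (presented_group X R) \<longleftrightarrow> (\<exists>w\<in>gwords X. A = pres_class X R w)" for A
    by (auto simp: presented_group_def quotient_def pres_class_def)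
  have app: "u @ v \<in> gwords X" if "u \<in> gwords X" "v \<in> gwords X" for u v :: "'a gword"
    using that by (auto simp: gwords_def)
  have nil: "[] \<in> gwords X" by (simp add: gwords_def)
  have one: "\<one>\<^bsub>presented_group X R\<^esub> = pres_class X R []" by (simp add: presented_group_def)
  fix A assume A: "A \<in> carrier (presented_group X R)"
  show "\<one>\<^bsub>presented_group X R\<^esub> \<otimes>\<^bsub>presented_group X R\<^esub> A = A"
    using A nil by (auto simp: car one pres_class_mult)
  show "\<exists>B\<in>carrier (presented_group X R). B \<otimes>\<^bsub>presented_group X R\<^esub> A = \<one>\<^bsub>presented_group X R\<^esub>"
  proof -
    from A obtain w where w: "w \<in> gwords X" "A = pres_class X R w" by (auto simp: car)
    obtain w' where "w' \<in> gwords X" "(w' @ w, []) \<in> pres_rel X R" using pres_inverse[OF w(1)] by blast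
    then show ?thesis
      using w equiv_class_eq[OF equiv_pres_rel, of "w' @ w" "[]" X R]
      by (intro bexI[of _ "pres_class X R w'"]) (auto simp: car one pres_class_mult pres_class_def[symmetric])
  qed
  fix B assume B: "B \<in> carrier (presented_group X R)"
  show "A \<otimes>\<^bsub>presented_group X R\<^esub> B \<in> carrier (presented_group X R)"
    using A B app by (auto simp: car pres_class_mult)
  fix C assume C: "C \<in> carrier (presented_group X R)"
  show "A \<otimes>\<^bsub>presented_group X R\<^esub> B \<otimes>\<^bsub>presented_group X R\<^esub> C
      = A \<otimes>\<^bsub>presented_group X R\<^esub> (B \<otimes>\<^bsub>presented_group X R\<^esub> C)"
    using A B C app by (auto simp: car pres_class_mult)
qed (auto simp: presented_group_def quotient_def pres_class_def gwords_def)

section \<open>Ascending HNN extensions\<close>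

datatype 'a hnn_gen = Base 'a | Stable

definition hnn_gens :: "('a, 'm) monoid_scheme \<Rightarrow> 'a hnn_gen set" where
  "hnn_gens N = insert Stable (Base ` carrier N)"

text \<open>The base group is presented by its multiplication table: all its elements are generators, and the
  relators are \<open>x y (x \<otimes> y)\<^sup>-\<^sup>1\<close>. The relators added for the stable letter \<open>t\<close> are
  \<open>t x t\<^sup>-\<^sup>1 (\<theta> x)\<^sup>-\<^sup>1\<close>.\<close>

definition hnn_relators :: "('a, 'm) monoid_scheme \<Rightarrow> ('a \<Rightarrow> 'a) \<Rightarrow> 'a hnn_gen gword set" where
  "hnn_relators N \<theta> =
     {[(Base x, True), (Base y, True), (Base (x \<otimes>\<^bsub>N\<^esub> y), False)] | x y. x \<in> carrier N \<and> y \<in> carrier N}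
   \<union> {[(Stable, True), (Base x, True), (Stable, False), (Base (\<theta> x), False)] | x. x \<in> carrier N}"

definition ascending_hnn :: "('a, 'm) monoid_scheme \<Rightarrow> ('a \<Rightarrow> 'a) \<Rightarrow> 'a hnn_gen gword set monoid" where
  "ascending_hnn N \<theta> = presented_group (hnn_gens N) (hnn_relators N \<theta>)"

definition hnn_base :: "('a, 'm) monoid_scheme \<Rightarrow> ('a \<Rightarrow> 'a) \<Rightarrow> 'a \<Rightarrow> 'a hnn_gen gword set" where
  "hnn_base N \<theta> x = pres_class (hnn_gens N) (hnn_relators N \<theta>) [(Base x, True)]"

definition hnn_stable :: "('a, 'm) monoid_scheme \<Rightarrow> ('a \<Rightarrow> 'a) \<Rightarrow> 'a hnn_gen gword set" where
  "hnn_stable N \<theta> = pres_class (hnn_gens N) (hnn_relators N \<theta>) [(Stable, True)]"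

definition cyclic_cover :: "('a, 'm) monoid_scheme \<Rightarrow> ('a \<Rightarrow> 'a) \<Rightarrow> nat \<Rightarrow> 'a hnn_gen gword set set" where
  "cyclic_cover N \<theta> n =
     generate (ascending_hnn N \<theta>)
       (hnn_base N \<theta> ` carrier N \<union> {hnn_stable N \<theta> [^]\<^bsub>ascending_hnn N \<theta>\<^esub> n})"

lemma group_ascending_hnn: "group (ascending_hnn N \<theta>)"
  by (simp add: ascending_hnn_def group_presented_group)

lemma hnn_relators_in_gwords:
  assumes "group N" "\<theta> \<in> carrier N \<rightarrow> carrier N"
  shows "hnn_relators N \<theta> \<subseteq> gwords (hnn_gens N)"
proof -
  interpret group N by fact
  have "\<theta> x \<in> carrier N" if "x \<in> carrier N" for x using assms(2) that by blast
  then show ?thesis by (auto simp: hnn_relators_def gwords_def hnn_gens_def)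
qed

end

theory Submission
  imports Defs "HOL-Algebra.Multiplicative_Group"
begin

text \<open>Write \<open>N = [G, G]\<close>. A subgroup \<open>H\<close> of finite index gives a map \<open>f\<close> from \<open>N\<close> to a finite group
  (the permutations of the cosets of \<open>H\<close>) and an element \<open>T\<close> of it with \<open>T f(x) T\<^sup>-\<^sup>1 = f(\<sigma> x)\<close>.
  It suffices that every such \<open>f\<close> is trivial: then \<open>H\<close> contains \<open>N\<close> and is the cyclic cover of the
  least \<open>n \<ge> 1\<close> with \<open>t\<^sup>n \<in> H\<close>.

  The endomorphism has the form \<open>\<sigma>(x) = (x', x)\<close>, and \<open>\<sigma>\<^sup>2(x) = (1, \<sigma>(x))\<close> for \<open>x \<in> N\<close>, so
  \<open>\<sigma>\<^sup>3(x)\<close> is supported below the vertex 11 and acts there as \<open>\<sigma>(x)\<close>. Conjugating by an element of \<open>N\<close>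
  that moves 11 yields commuting elements, whence \<open>f(N)\<close> is abelian. Every \<open>\<sigma>\<^sup>3(g)\<close>
  with \<open>g \<in> {a, c, d}\<close> agrees below 11 with an element of \<open>N\<close>, whence \<open>f\<close> is invariant under
  conjugation by \<open>G\<close>. Conjugation by \<open>a\<close> inverts \<open>[a,c]\<close>, so \<open>f([a,c])\<^sup>2 = 1\<close>;
  since \<open>\<sigma>[a,d] = [a,c]\<^sup>2\<close> and \<open>\<sigma>[a,c] = [a,c] d[a,c]d\<close>, this forces \<open>f([a,d]) = f([a,c]) = 1\<close>,
  and \<open>(g,h) \<mapsto> f([g,h])\<close> is bimultiplicative.\<close>

section \<open>The group and its commutator subgroup\<close>

text \<open>Reduces to words built one letter at a time. The product clause of
  \<open>generate\<close> joins two arbitrary factors, so the induction shows that left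
  multiplication by \<open>x\<close> preserves \<open>P\<close>, a property that composes.\<close>

lemma (in group) generate_symmetric_induct [consumes 1, case_names subset inv one step]:
  assumes "x \<in> generate G S"
    and "S \<subseteq> carrier G"
    and "\<And>s. s \<in> S \<Longrightarrow> inv s \<in> S"
    and "P \<one>"
    and "\<And>s y. s \<in> S \<Longrightarrow> y \<in> generate G S \<Longrightarrow> P y \<Longrightarrow> P (s \<otimes> y)"
  shows "P x"
proof -
  have sub: "generate G S \<subseteq> carrier G"
    using assms(2) by (rule generate_incl)
  have "\<forall>y \<in> generate G S. P y \<longrightarrow> P (x \<otimes> y)"
    using assms(1)
  proof (induction rule: generate.induct)
    case one
    then show ?case using sub by auto
  next
    case (incl h)
    then show ?case using assms(5) by blast
  next
    case (inv h)
    then show ?case using assms(3,5) by blast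
  next
    case (eng h1 h2)
    show ?case
    proof (intro ballI impI)
      fix y assume y: "y \<in> generate G S" "P y"
      then have "P (h2 \<otimes> y)" "h2 \<otimes> y \<in> generate G S"
        using eng generate.eng[OF eng(2)] by auto
      then have "P (h1 \<otimes> (h2 \<otimes> y))" using eng by blast
      then show "P (h1 \<otimes> h2 \<otimes> y)" using eng(1,2) y(1) sub m_assoc[of h1 h2 y] by (metis subsetD)
    qed
  qed
  then show ?thesis
    using assms(1,4) generate.one[of G S] sub r_one[of x] by (metis subsetD)
qed

text \<open>Serves both the finite quotient, with \<open>f\<close> and \<open>\<sigma>\<close>, and
  the HNN extension, with the base embedding and \<open>\<theta>\<close>. Intertwining instead of
  conjugating avoids inverses.\<close>

lemma (in group) nat_pow_intertwine:
  assumes T: "T \<in> carrier G"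
    and g: "\<And>x. x \<in> A \<Longrightarrow> g x \<in> carrier G"
    and \<theta>: "\<And>x. x \<in> A \<Longrightarrow> \<theta> x \<in> A"
    and eq: "\<And>x. x \<in> A \<Longrightarrow> T \<otimes> g x = g (\<theta> x) \<otimes> T"
    and x: "x \<in> A"
  shows "T [^] (k::nat) \<otimes> g x = g ((\<theta> ^^ k) x) \<otimes> T [^] k"
proof (induction k)
  case 0
  then show ?case using g x by simp
next
  case (Suc k)
  let ?y = "(\<theta> ^^ k) x"
  have y: "?y \<in> A" by (induction k) (auto simp: x \<theta>)
  have "T [^] Suc k \<otimes> g x = T \<otimes> (T [^] k \<otimes> g x)"
    using T g x by (simp only: nat_pow_Suc2 m_assoc nat_pow_closed)
  also have "\<dots> = T \<otimes> g ?y \<otimes> T [^] k"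
    using Suc T g y by (simp add: m_assoc)
  also have "\<dots> = g (\<theta> ?y) \<otimes> (T \<otimes> T [^] k)"
    using eq[OF y] T g \<theta> y by (simp add: m_assoc)
  finally show ?case using T by (simp only: nat_pow_Suc2) simp
qed

section \<open>Arithmetic in the Grigorchuk group as composition of maps\<close>

lemma carrier_Grigorchuk_subset: "carrier Grigorchuk \<subseteq> tree_automorphisms"
  using group.generate_incl[OF group_Tree_Aut] grig_gens_automorphisms
  by (simp add: Grigorchuk_def Tree_Aut_def)

lemma Grigorchuk_mult:
  assumes "f \<in> carrier Grigorchuk" "g \<in> carrier Grigorchuk"
  shows "f \<otimes>\<^bsub>Grigorchuk\<^esub> g = f \<circ> g"
  using Tree_Aut_mult[of f g] assms carrier_Grigorchuk_subset by (auto simp: Grigorchuk_def)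

lemma Tree_Aut_one: "\<one>\<^bsub>Tree_Aut\<^esub> = id"
  by (auto simp: Tree_Aut_def BijGroup_def)

lemma Grigorchuk_one: "\<one>\<^bsub>Grigorchuk\<^esub> = id"
  by (simp add: Grigorchuk_def Tree_Aut_one)

lemma Grigorchuk_comp_closed:
  "f \<in> carrier Grigorchuk \<Longrightarrow> g \<in> carrier Grigorchuk \<Longrightarrow> f \<circ> g \<in> carrier Grigorchuk"
  using monoid.m_closed[OF group.is_monoid[OF group_Grigorchuk]] Grigorchuk_mult by metis

lemma Grigorchuk_id_closed: "id \<in> carrier Grigorchuk"
  using monoid.one_closed[OF group.is_monoid[OF group_Grigorchuk]] Grigorchuk_one by metis

lemma Grigorchuk_inv_closed:
  "g \<in> carrier Grigorchuk \<Longrightarrow> inv\<^bsub>Grigorchuk\<^esub> g \<in> carrier Grigorchuk"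
  using group.inv_closed[OF group_Grigorchuk] .

lemma Grigorchuk_inv_apply:
  assumes "g \<in> carrier Grigorchuk"
  shows "(inv\<^bsub>Grigorchuk\<^esub> g) (g w) = w" "g ((inv\<^bsub>Grigorchuk\<^esub> g) w) = w"
  using group.l_inv[OF group_Grigorchuk assms] group.r_inv[OF group_Grigorchuk assms]
    Grigorchuk_mult Grigorchuk_inv_closed assms Grigorchuk_one
  by (metis comp_apply id_apply)+

lemma Grigorchuk_inv_unique:
  assumes "g \<in> carrier Grigorchuk" "h \<in> carrier Grigorchuk" "g \<circ> h = id"
  shows "inv\<^bsub>Grigorchuk\<^esub> g = h"
  using Grigorchuk_inv_apply(1)[OF assms(1)] assms(3) by (metis comp_apply id_apply ext)

lemma Grigorchuk_inv_comp:
  assumes "g \<in> carrier Grigorchuk" "h \<in> carrier Grigorchuk"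
  shows "inv\<^bsub>Grigorchuk\<^esub> (g \<circ> h) = inv\<^bsub>Grigorchuk\<^esub> h \<circ> inv\<^bsub>Grigorchuk\<^esub> g"
  using assms
  by (intro Grigorchuk_inv_unique Grigorchuk_comp_closed Grigorchuk_inv_closed)
     (auto simp: Grigorchuk_inv_apply)

lemma Grigorchuk_root: "g \<in> carrier Grigorchuk \<Longrightarrow> g [] = []"
  using carrier_Grigorchuk_subset by (auto simp: tree_automorphisms_def)

lemma grig_gens_closed:
  "grig_a \<in> carrier Grigorchuk" "grig_b \<in> carrier Grigorchuk"
  "grig_c \<in> carrier Grigorchuk" "grig_d \<in> carrier Grigorchuk"
  by (auto simp: Grigorchuk_def intro: generate.incl)

lemmas grig_invol = grig_a_invol grig_bcd_invol

lemma grig_gens_inv: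
  "inv\<^bsub>Grigorchuk\<^esub> grig_a = grig_a" "inv\<^bsub>Grigorchuk\<^esub> grig_b = grig_b"
  "inv\<^bsub>Grigorchuk\<^esub> grig_c = grig_c" "inv\<^bsub>Grigorchuk\<^esub> grig_d = grig_d"
  by (auto intro!: Grigorchuk_inv_unique simp: grig_gens_closed grig_invol)

text \<open>\<open>d = (1, b)\<close> and \<open>ada = (b, 1)\<close> act on different subtrees and
  so commute; this is the relation \<open>(ad)^4 = 1\<close>.\<close>

lemma grig_dada: "grig_d (grig_a (grig_d (grig_a w))) = grig_a (grig_d (grig_a (grig_d w)))"
  by (cases w rule: grig_d.cases) (auto simp: grig_invol)

lemma Tree_Aut_inv_eq:
  assumes "s \<in> tree_automorphisms" "\<And>w. s (s w) = w"
  shows "inv\<^bsub>Tree_Aut\<^esub> s = s"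
proof -
  have "s \<otimes>\<^bsub>Tree_Aut\<^esub> s = \<one>\<^bsub>Tree_Aut\<^esub>"
    using assms by (auto simp: Tree_Aut_mult Tree_Aut_one)
  then show ?thesis
    using group.inv_equality[OF group_Tree_Aut, of s s] assms(1) by (simp add: Tree_Aut_def)
qed

text \<open>The letter \<open>b\<close> is eliminated because \<open>\<sigma>\<close> is prescribed
  on \<open>a\<close>, \<open>c\<close>, \<open>d\<close> only.\<close>

lemma Grigorchuk_induct [consumes 1, case_names id step]:
  assumes g: "g \<in> carrier Grigorchuk"
    and id: "P id"
    and step: "\<And>s g. s \<in> {grig_a, grig_c, grig_d} \<Longrightarrow> g \<in> carrier Grigorchuk \<Longrightarrow> P g \<Longrightarrow> P (s \<circ> g)"
  shows "P g"
proof -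
  let ?S = "{grig_a, grig_b, grig_c, grig_d}"
  have gen: "generate Tree_Aut ?S = carrier Grigorchuk"
    by (simp add: Grigorchuk_def)
  have S: "?S \<subseteq> carrier Tree_Aut"
    using grig_gens_automorphisms by (simp add: Tree_Aut_def)
  have "g \<in> generate Tree_Aut ?S" using g gen by simp
  then show ?thesis
  proof (induction rule: group.generate_symmetric_induct[OF group_Tree_Aut, consumes 1, case_names subset inv one step])
    case subset then show ?case using S by simp
  next
    case (inv s)
    then show ?case
      using Tree_Aut_inv_eq grig_gens_automorphisms grig_invol by auto
  next
    case one then show ?case unfolding Tree_Aut_one by (rule id)
  next
    case (step s y)
    then have y: "y \<in> carrier Grigorchuk" using gen by simp
    moreover have "s \<in> tree_automorphisms" using step grig_gens_automorphisms by auto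
    ultimately have eq: "s \<otimes>\<^bsub>Tree_Aut\<^esub> y = s \<circ> y"
      using Tree_Aut_mult carrier_Grigorchuk_subset by auto
    \<comment> \<open>One step with \<open>b\<close> becomes two steps, with \<open>d\<close> and
      then with \<open>c\<close>.\<close>
    have b: "grig_b \<circ> y = grig_c \<circ> (grig_d \<circ> y)"
      by (auto simp: grig_cd_eq_b)
    have "P (s \<circ> y)"
    proof (cases "s = grig_b")
      case True
      then show ?thesis
        using assms(3)[of grig_d y] assms(3)[of grig_c "grig_d \<circ> y"] y step(3) b
          Grigorchuk_comp_closed grig_gens_closed by auto
    next
      case False
      then show ?thesis using assms(3) y step by auto
    qed
    then show ?case unfolding eq .
  qed
qed

section \<open>The commutator subgroup \<open>N\<close>\<close>

abbreviation grig_derived :: "(vertex \<Rightarrow> vertex) set" where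
  "grig_derived \<equiv> derived Grigorchuk (carrier Grigorchuk)"

definition grig_commutator :: "(vertex \<Rightarrow> vertex) \<Rightarrow> (vertex \<Rightarrow> vertex) \<Rightarrow> vertex \<Rightarrow> vertex" where
  "grig_commutator g h = g \<circ> h \<circ> inv\<^bsub>Grigorchuk\<^esub> g \<circ> inv\<^bsub>Grigorchuk\<^esub> h"

lemma derived_set_Grigorchuk:
  "derived_set Grigorchuk (carrier Grigorchuk)
    = {grig_commutator g h | g h. g \<in> carrier Grigorchuk \<and> h \<in> carrier Grigorchuk}"
proof -
  have "g \<otimes>\<^bsub>Grigorchuk\<^esub> h \<otimes>\<^bsub>Grigorchuk\<^esub> inv\<^bsub>Grigorchuk\<^esub> g \<otimes>\<^bsub>Grigorchuk\<^esub> inv\<^bsub>Grigorchuk\<^esub> h = grig_commutator g h"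
    if "g \<in> carrier Grigorchuk" "h \<in> carrier Grigorchuk" for g h
    using that
    by (simp add: Grigorchuk_mult Grigorchuk_comp_closed Grigorchuk_inv_closed grig_commutator_def)
  then show ?thesis by fastforce
qed

lemma grig_commutator_closed:
  "g \<in> carrier Grigorchuk \<Longrightarrow> h \<in> carrier Grigorchuk \<Longrightarrow> grig_commutator g h \<in> carrier Grigorchuk"
  by (simp add: grig_commutator_def Grigorchuk_comp_closed Grigorchuk_inv_closed)

lemma grig_commutator_derived:
  "g \<in> carrier Grigorchuk \<Longrightarrow> h \<in> carrier Grigorchuk \<Longrightarrow> grig_commutator g h \<in> grig_derived"
  unfolding derived_def derived_set_Grigorchuk by (rule generate.incl) blast

lemma inv_grig_commutator:
  assumes "g \<in> carrier Grigorchuk" "h \<in> carrier Grigorchuk"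
  shows "inv\<^bsub>Grigorchuk\<^esub> (grig_commutator g h) = grig_commutator h g"
  by (rule Grigorchuk_inv_unique)
     (use assms in \<open>simp_all add: grig_commutator_closed\<close>,
       simp add: grig_commutator_def fun_eq_iff Grigorchuk_inv_apply)

lemma subgroup_grig_derived: "subgroup grig_derived Grigorchuk"
  using group.derived_is_subgroup[OF group_Grigorchuk] by simp

lemma grig_derived_carrier: "x \<in> grig_derived \<Longrightarrow> x \<in> carrier Grigorchuk"
  using subgroup.subset[OF subgroup_grig_derived] by auto

lemma grig_derived_comp:
  assumes "x \<in> grig_derived" "y \<in> grig_derived"
  shows "x \<circ> y \<in> grig_derived"
  using subgroup.m_closed[OF subgroup_grig_derived assms] Grigorchuk_mult[of x y] assms
  by (simp add: grig_derived_carrier)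

lemma grig_derived_id: "id \<in> grig_derived"
  using subgroup.one_closed[OF subgroup_grig_derived] Grigorchuk_one by simp

lemma grig_derived_inv: "x \<in> grig_derived \<Longrightarrow> inv\<^bsub>Grigorchuk\<^esub> x \<in> grig_derived"
  using subgroup.m_inv_closed[OF subgroup_grig_derived] .

text \<open>Normality comes from \<open>g x g^-1 = [g, x] x\<close>.\<close>

lemma grig_derived_conj:
  assumes "g \<in> carrier Grigorchuk" "x \<in> grig_derived"
  shows "g \<circ> x \<circ> inv\<^bsub>Grigorchuk\<^esub> g \<in> grig_derived"
proof -
  have x: "x \<in> carrier Grigorchuk" using assms grig_derived_carrier by simp
  have "g \<circ> x \<circ> inv\<^bsub>Grigorchuk\<^esub> g = grig_commutator g x \<circ> x"
    using x by (auto simp: grig_commutator_def Grigorchuk_inv_apply)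
  then show ?thesis using grig_derived_comp grig_commutator_derived assms x by metis
qed

text \<open>The inverse of \<open>[g, h]\<close> is \<open>[h, g]\<close>, so the commutators form a
  symmetric generating set and inverses cause no extra case.\<close>

lemma grig_derived_induct [consumes 1, case_names id step]:
  assumes x: "x \<in> grig_derived"
    and id: "P id"
    and step: "\<And>g h y. g \<in> carrier Grigorchuk \<Longrightarrow> h \<in> carrier Grigorchuk
      \<Longrightarrow> y \<in> grig_derived \<Longrightarrow> P y \<Longrightarrow> P (grig_commutator g h \<circ> y)"
  shows "P x"
proof -
  let ?S = "derived_set Grigorchuk (carrier Grigorchuk)"
  have "x \<in> generate Grigorchuk ?S" using x by (simp add: derived_def)
  then show ?thesis
  proof (induction rule: group.generate_symmetric_induct[OF group_Grigorchuk, consumes 1, case_names subset inv one step])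
    case subset
    then show ?case using grig_commutator_closed by (auto simp: derived_set_Grigorchuk)
  next
    case (inv s)
    then show ?case using inv_grig_commutator unfolding derived_set_Grigorchuk by blast
  next
    case one then show ?case unfolding Grigorchuk_one by (rule id)
  next
    case (step s y)
    then obtain g h where "g \<in> carrier Grigorchuk" "h \<in> carrier Grigorchuk" "s = grig_commutator g h"
      unfolding derived_set_Grigorchuk by blast
    moreover have "y \<in> grig_derived" using step by (simp add: derived_def)
    ultimately have "P (s \<circ> y)" "s \<otimes>\<^bsub>Grigorchuk\<^esub> y = s \<circ> y"
      using assms(3)[of g h y] step(3) Grigorchuk_mult[of s y] grig_commutator_closed[of g h]
        grig_derived_carrier by blast+
    then show ?case by metis
  qed
qed

lemma grig_ac_derived: "grig_a \<circ> grig_c \<circ> grig_a \<circ> grig_c \<in> grig_derived"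
  using grig_commutator_derived[of grig_a grig_c]
  by (simp add: grig_gens_closed grig_commutator_def grig_gens_inv)

lemma grig_ad_derived: "grig_a \<circ> grig_d \<circ> grig_a \<circ> grig_d \<in> grig_derived"
  using grig_commutator_derived[of grig_a grig_d]
  by (simp add: grig_gens_closed grig_commutator_def grig_gens_inv)

section \<open>Automorphisms supported below the vertex 11\<close>

definition supported_11 :: "(vertex \<Rightarrow> vertex) \<Rightarrow> bool" where
  "supported_11 z \<longleftrightarrow> (\<forall>w. (\<nexists>v. w = True # True # v) \<longrightarrow> z w = w)
     \<and> (\<forall>v. \<exists>v'. z (True # True # v) = True # True # v')"

text \<open>The conjugate by \<open>g\<close> is supported on the \<open>g\<close>-image of the
  subtree below 11. By \<open>off\<close> this is disjoint from the subtree, and maps with disjoint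
  supports commute.\<close>

lemma supported_11_conj_commute:
  assumes g: "g \<in> carrier Grigorchuk" and z: "supported_11 z1" "supported_11 z2"
    and off: "\<And>v v'. g (True # True # v) \<noteq> True # True # v'"
  shows "(g \<circ> z1 \<circ> inv\<^bsub>Grigorchuk\<^esub> g) \<circ> z2 = z2 \<circ> (g \<circ> z1 \<circ> inv\<^bsub>Grigorchuk\<^esub> g)"
proof
  fix w
  let ?h = "inv\<^bsub>Grigorchuk\<^esub> g"
  have gh: "g (?h v) = v" for v
    by (rule Grigorchuk_inv_apply(2)[OF g])
  \<comment> \<open>Applying \<open>g\<close> to a counterexample would contradict
    \<open>off\<close>.\<close>
  have off': "?h (True # True # v) \<noteq> True # True # v'" for v v'
    using off gh by metis
  show "((g \<circ> z1 \<circ> ?h) \<circ> z2) w = (z2 \<circ> (g \<circ> z1 \<circ> ?h)) w"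
  proof (cases "\<exists>v. w = True # True # v")
    case True
    then obtain v v' where "w = True # True # v" "z2 w = True # True # v'"
      using z(2) unfolding supported_11_def by blast
    then have "z1 (?h w) = ?h w" "z1 (?h (z2 w)) = ?h (z2 w)"
      using z(1) off' unfolding supported_11_def by (simp_all)
    then show ?thesis by (simp add: gh)
  next
    case False
    then have w: "z2 w = w" using z(2) unfolding supported_11_def by blast
    show ?thesis
    proof (cases "\<exists>v. ?h w = True # True # v")
      case True
      then obtain v' where "z1 (?h w) = True # True # v'"
        using z(1) unfolding supported_11_def by metis
      then have "z2 (g (z1 (?h w))) = g (z1 (?h w))"
        using off z(2) unfolding supported_11_def by simp
      then show ?thesis by (simp add: w)
    next
      case False
      then have "z1 (?h w) = ?h w" using z(1) unfolding supported_11_def by blast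
      then show ?thesis by (simp add: w gh)
    qed
  qed
qed

text \<open>Conjugating \<open>z\<close> by \<open>p\<close> only involves the values of
  \<open>p\<close> below 11, where \<open>z\<close> lives. This lets a conjugator outside
  \<open>N\<close> be exchanged for one inside \<open>N\<close>.\<close>

lemma supported_11_conj_cong:
  assumes p: "p \<in> carrier Grigorchuk" and q: "q \<in> carrier Grigorchuk" and z: "supported_11 z"
    and eq: "\<And>v. p (True # True # v) = q (True # True # v)"
  shows "p \<circ> z \<circ> inv\<^bsub>Grigorchuk\<^esub> p = q \<circ> z \<circ> inv\<^bsub>Grigorchuk\<^esub> q"
proof
  fix w
  let ?p = "inv\<^bsub>Grigorchuk\<^esub> p" and ?q = "inv\<^bsub>Grigorchuk\<^esub> q"
  note inv = Grigorchuk_inv_apply[OF p] Grigorchuk_inv_apply[OF q]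
  show "(p \<circ> z \<circ> ?p) w = (q \<circ> z \<circ> ?q) w"
  proof (cases "\<exists>v. ?p w = True # True # v")
    case True
    then obtain v where v: "?p w = True # True # v" by blast
    then have "q (True # True # v) = w" using eq inv by metis
    then have "?q w = True # True # v" using inv by metis
    moreover obtain v' where "z (True # True # v) = True # True # v'"
      using z unfolding supported_11_def by blast
    ultimately show ?thesis using v eq by simp
  next
    case False
    then have "\<nexists>v. ?q w = True # True # v" using eq inv by metis
    then have "z (?p w) = ?p w" "z (?q w) = ?q w"
      using False z unfolding supported_11_def by blast+
    then show ?thesis by (simp add: inv)
  qed
qed

section \<open>The endomorphism\<close>

text \<open>The substitution of Lysenok, with the image \<open>dc\<close> of \<open>c\<close>
  written as \<open>b\<close>. On the two subtrees it reads \<open>\<sigma>(a) = (d, a)\<close>,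
  \<open>\<sigma>(c) = (a, c)\<close>, \<open>\<sigma>(d) = (a, d)\<close>.\<close>

locale Lysenok_endomorphism =
  fixes \<sigma> :: "(vertex \<Rightarrow> vertex) \<Rightarrow> (vertex \<Rightarrow> vertex)"
  assumes hom: "\<sigma> \<in> hom Grigorchuk Grigorchuk"
    and a: "\<sigma> grig_a = grig_a \<circ> grig_c \<circ> grig_a"
    and c: "\<sigma> grig_c = grig_b"
    and d: "\<sigma> grig_d = grig_c"
begin

lemma closed: "g \<in> carrier Grigorchuk \<Longrightarrow> \<sigma> g \<in> carrier Grigorchuk"
  using hom by (auto simp: hom_def)

lemma map_comp:
  assumes "g \<in> carrier Grigorchuk" "h \<in> carrier Grigorchuk"
  shows "\<sigma> (g \<circ> h) = \<sigma> g \<circ> \<sigma> h"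
  using hom_mult[OF hom assms] assms by (simp add: Grigorchuk_mult closed)

lemma map_id: "\<sigma> id = id"
  using hom_one[OF hom group_Grigorchuk group_Grigorchuk] by (simp add: Grigorchuk_one)

lemma map_inv:
  assumes "g \<in> carrier Grigorchuk"
  shows "\<sigma> (inv\<^bsub>Grigorchuk\<^esub> g) = inv\<^bsub>Grigorchuk\<^esub> (\<sigma> g)"
proof -
  have "g \<circ> inv\<^bsub>Grigorchuk\<^esub> g = id" using assms by (auto simp: Grigorchuk_inv_apply)
  then show ?thesis
    using map_comp[of g "inv\<^bsub>Grigorchuk\<^esub> g"] assms map_id
      Grigorchuk_inv_unique[of "\<sigma> g" "\<sigma> (inv\<^bsub>Grigorchuk\<^esub> g)"]
    by (simp add: closed Grigorchuk_inv_closed)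
qed

lemma derived_closed: "x \<in> grig_derived \<Longrightarrow> \<sigma> x \<in> grig_derived"
proof (induction rule: grig_derived_induct)
  case id
  show ?case unfolding map_id by (rule grig_derived_id)
next
  case (step g h y)
  then have "\<sigma> (grig_commutator g h \<circ> y) = grig_commutator (\<sigma> g) (\<sigma> h) \<circ> \<sigma> y"
    by (simp add: grig_commutator_def map_comp map_inv closed Grigorchuk_comp_closed Grigorchuk_inv_closed
        grig_derived_carrier)
  moreover have "grig_commutator (\<sigma> g) (\<sigma> h) \<circ> \<sigma> y \<in> grig_derived"
    using step by (simp add: grig_derived_comp grig_commutator_derived closed)
  ultimately show ?case by metis
qed

text \<open>The images of \<open>a\<close>, \<open>c\<close>, \<open>d\<close> have second
  coordinates \<open>a\<close>, \<open>c\<close>, \<open>d\<close>, and both sides are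
  multiplicative.\<close>

lemma apply_True: "g \<in> carrier Grigorchuk \<Longrightarrow> \<sigma> g (True # w) = True # g w"
proof (induction arbitrary: w rule: Grigorchuk_induct)
  case id
  show ?case unfolding map_id by simp
next
  case (step s g)
  have "\<sigma> (s \<circ> g) (True # w) = \<sigma> s (True # g w)"
    using map_comp[of s g] grig_gens_closed step by auto
  also have "\<dots> = True # (s \<circ> g) w" using step(1) by (auto simp: a c d)
  finally show ?case .
qed

text \<open>Makes second iterates computable:
  \<open>\<sigma>^2(c) = \<sigma>(b) = d\<close>.\<close>

lemma b: "\<sigma> grig_b = grig_d"
proof -
  have "grig_b = grig_c \<circ> grig_d" by (auto simp: grig_cd_eq_b)
  then have "\<sigma> grig_b = grig_b \<circ> grig_c" using map_comp[of grig_c grig_d] grig_gens_closed c d by simp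
  also have "\<dots> = grig_d"
    using grig_cd_eq_b(2) grig_bcd_invol by (metis comp_apply ext)
  finally show ?thesis .
qed

text \<open>On the first subtree \<open>\<sigma>\<^sup>2\<close> acts through the Klein four-group generated by \<open>a\<close> and \<open>dad\<close>,
  and an abelian image kills the commutator subgroup.\<close>

lemma sq_False:
  "g \<in> carrier Grigorchuk \<Longrightarrow>
    \<exists>e \<in> {id, grig_a, grig_d \<circ> grig_a \<circ> grig_d, grig_a \<circ> grig_d \<circ> grig_a \<circ> grig_d}.
      \<forall>w. \<sigma> (\<sigma> g) (False # w) = False # e w"
  (is "_ \<Longrightarrow> \<exists>e \<in> ?V. _")
proof (induction rule: Grigorchuk_induct)
  case id
  show ?case unfolding map_id by simp
next
  case (step s g)
  then obtain e where e: "e \<in> ?V" "\<And>w. \<sigma> (\<sigma> g) (False # w) = False # e w" by blast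
  have s: "s \<in> carrier Grigorchuk" using step grig_gens_closed by auto
  \<comment> \<open>On the first subtree \<open>\<sigma>^2(a)\<close> acts as \<open>dad\<close>,
    \<open>\<sigma>^2(c) = d\<close> as the identity and \<open>\<sigma>^2(d) = b\<close> as
    \<open>a\<close>.\<close>
  have "\<exists>e' \<in> {id, grig_a, grig_d \<circ> grig_a \<circ> grig_d}. \<forall>w. \<sigma> (\<sigma> s) (False # w) = False # e' w"
    using step(1) by (auto simp: a b c d map_comp grig_gens_closed Grigorchuk_comp_closed)
  then obtain e' where e': "e' \<in> {id, grig_a, grig_d \<circ> grig_a \<circ> grig_d}"
    "\<And>w. \<sigma> (\<sigma> s) (False # w) = False # e' w" by blast
  have "e' \<circ> e \<in> ?V"
  proof -
    \<comment> \<open>The part of the multiplication table of the four-group that is used;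
      \<open>grig_dada\<close> makes \<open>a\<close> and \<open>dad\<close> commute.\<close>
    have 1: "grig_a \<circ> (grig_d \<circ> grig_a \<circ> grig_d) = grig_a \<circ> grig_d \<circ> grig_a \<circ> grig_d"
      "grig_a \<circ> (grig_a \<circ> grig_d \<circ> grig_a \<circ> grig_d) = grig_d \<circ> grig_a \<circ> grig_d"
      "grig_a \<circ> grig_a = id"
      "grig_d \<circ> grig_a \<circ> grig_d \<circ> grig_a = grig_a \<circ> grig_d \<circ> grig_a \<circ> grig_d"
      "grig_d \<circ> grig_a \<circ> grig_d \<circ> (grig_d \<circ> grig_a \<circ> grig_d) = id"
      "grig_d \<circ> grig_a \<circ> grig_d \<circ> (grig_a \<circ> grig_d \<circ> grig_a \<circ> grig_d) = grig_a"
      by (auto simp: grig_invol grig_dada)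
    show ?thesis using e(1) e'(1) by (elim insertE emptyE) (simp_all only: 1 comp_id id_comp insert_iff simp_thms)
  qed
  moreover have "\<sigma> (\<sigma> (s \<circ> g)) (False # w) = False # (e' \<circ> e) w" for w
    using step s by (simp add: map_comp closed e e')
  ultimately show ?case by blast
qed

lemma sq_derived_False: "x \<in> grig_derived \<Longrightarrow> \<sigma> (\<sigma> x) (False # w) = False # w"
proof (induction arbitrary: w rule: grig_derived_induct)
  case id
  show ?case unfolding map_id by simp
next
  case (step g h y)
  let ?V = "{id, grig_a, grig_d \<circ> grig_a \<circ> grig_d, grig_a \<circ> grig_d \<circ> grig_a \<circ> grig_d}"
  have V_comm: "e (e' v) = e' (e v)" if "e \<in> ?V" "e' \<in> ?V" for e e' v
    using that by (auto simp: grig_dada grig_invol)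
  have V_invol: "e (e v) = v" if "e \<in> ?V" for e v
    using that by (auto simp: grig_dada grig_invol)
  \<comment> \<open>All elements of \<open>?V\<close> are involutions, so the inverse of
    \<open>\<sigma>^2(k)\<close> acts on the first subtree by the same \<open>e\<close>.\<close>
  have "\<exists>e \<in> ?V. \<forall>v. \<sigma> (\<sigma> k) (False # v) = False # e v
      \<and> (inv\<^bsub>Grigorchuk\<^esub> (\<sigma> (\<sigma> k))) (False # v) = False # e v"
    if k: "k \<in> carrier Grigorchuk" for k
  proof -
    obtain e where e: "e \<in> ?V" "\<And>v. \<sigma> (\<sigma> k) (False # v) = False # e v"
      using sq_False[OF k] by blast
    have "(inv\<^bsub>Grigorchuk\<^esub> (\<sigma> (\<sigma> k))) (False # v) = False # e v" for v
    proof -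
      have "\<sigma> (\<sigma> k) (False # e v) = False # v" using e V_invol by simp
      then show ?thesis using Grigorchuk_inv_apply(1)[of "\<sigma> (\<sigma> k)"] closed k by metis
    qed
    then show ?thesis using e by blast
  qed
  from this[of g] this[of h] step obtain e e' where e: "e \<in> ?V" "e' \<in> ?V"
    "\<And>v. \<sigma> (\<sigma> g) (False # v) = False # e v" "\<And>v. (inv\<^bsub>Grigorchuk\<^esub> (\<sigma> (\<sigma> g))) (False # v) = False # e v"
    "\<And>v. \<sigma> (\<sigma> h) (False # v) = False # e' v" "\<And>v. (inv\<^bsub>Grigorchuk\<^esub> (\<sigma> (\<sigma> h))) (False # v) = False # e' v"
    by metis
  \<comment> \<open>The commutator acts as \<open>e e' e e'\<close>, which is trivial for commuting
    involutions.\<close>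
  have "\<sigma> (\<sigma> (grig_commutator g h \<circ> y)) (False # w) = False # e (e' (e (e' w)))"
    using step e
    by (simp add: grig_commutator_def map_comp map_inv closed Grigorchuk_comp_closed Grigorchuk_inv_closed
        grig_derived_carrier)
  then show ?case using V_comm[OF e(1,2)] V_invol e(1,2) by metis
qed

lemma cube_True: "g \<in> carrier Grigorchuk \<Longrightarrow> \<sigma> (\<sigma> (\<sigma> g)) (True # True # w) = True # True # \<sigma> g w"
  by (simp add: apply_True closed)

text \<open>Use \<open>\<sigma>^2(x) = (1, \<sigma>(x))\<close> twice: for
  \<open>\<sigma>(x)\<close> it shows that \<open>\<sigma>^3(x)\<close> fixes the first subtree and
  acts as \<open>\<sigma>^2(x)\<close> on the second, and for \<open>x\<close> that this action is
  trivial off the second half.\<close>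

lemma cube_supported:
  assumes x: "x \<in> grig_derived"
  shows "supported_11 (\<sigma> (\<sigma> (\<sigma> x)))"
  unfolding supported_11_def
proof (intro conjI allI impI)
  have G: "x \<in> carrier Grigorchuk" using x grig_derived_carrier by simp
  show "\<exists>v'. \<sigma> (\<sigma> (\<sigma> x)) (True # True # v) = True # True # v'" for v
    using cube_True[OF G] by blast
  fix w :: vertex assume w: "\<nexists>v. w = True # True # v"
  show "\<sigma> (\<sigma> (\<sigma> x)) w = w"
  proof (cases w)
    case Nil
    then show ?thesis using G Grigorchuk_root closed by simp
  next
    case (Cons i v)
    show ?thesis
    proof (cases i)
      case False
      then show ?thesis using Cons sq_derived_False[OF derived_closed[OF x]] by simp
    next
      case True
      then have eq: "\<sigma> (\<sigma> (\<sigma> x)) w = True # \<sigma> (\<sigma> x) v"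
        using Cons G by (simp add: apply_True closed)
      have "\<sigma> (\<sigma> x) v = v"
      proof (cases v)
        case Nil
        then show ?thesis using G Grigorchuk_root closed by simp
      next
        case (Cons j v')
        then have "\<not> j" using w \<open>w = i # v\<close> True by auto
        then show ?thesis using Cons sq_derived_False[OF x] by simp
      qed
      then show ?thesis using eq Cons True by simp
    qed
  qed
qed

text \<open>By \<open>cube_True\<close>, \<open>\<sigma>^3(s)\<close> acts below 11 as
  \<open>aca\<close>, \<open>b\<close> or \<open>c\<close>. Elements of \<open>N\<close> with these
  actions suffice, as only the action below 11 matters for conjugating elements supported
  there.\<close>

lemma cube_gen_derived:
  assumes "s \<in> {grig_a, grig_c, grig_d}"
  shows "\<exists>p \<in> grig_derived. \<forall>v. p (True # True # v) = \<sigma> (\<sigma> (\<sigma> s)) (True # True # v)"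
proof -
  let ?u = "grig_a \<circ> grig_c \<circ> grig_a \<circ> grig_c" and ?v = "grig_a \<circ> grig_d \<circ> grig_a \<circ> grig_d"
  let ?k = "grig_a \<circ> grig_c \<circ> grig_a"
  have k: "?k \<in> carrier Grigorchuk" "inv\<^bsub>Grigorchuk\<^esub> ?k = ?k"
    by (auto simp: grig_gens_closed Grigorchuk_comp_closed grig_invol intro!: Grigorchuk_inv_unique)
  have kv: "?k \<circ> ?v \<circ> ?k \<in> grig_derived"
    using grig_derived_conj[OF k(1) grig_ad_derived] k(2) by simp
  \<comment> \<open>Below 11, \<open>?v\<close> acts as \<open>c\<close> and
    \<open>?u \<circ> ?u\<close> as \<open>b\<close>. Since \<open>?k\<close> exchanges 11 and 10,
    and \<open>?v\<close> acts as \<open>a\<close> below 10, the conjugate of \<open>?v\<close> by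
    \<open>?k\<close> acts below 11 as \<open>a\<close>; the product then acts as
    \<open>aca\<close>.\<close>
  let ?pa = "(?k \<circ> ?v \<circ> ?k) \<circ> ?v \<circ> (?k \<circ> ?v \<circ> ?k)"
  have "?pa \<in> grig_derived" "?u \<circ> ?u \<in> grig_derived" "?v \<in> grig_derived"
    using kv grig_ad_derived grig_ac_derived grig_derived_comp by blast+
  moreover have "\<forall>v. ?pa (True # True # v) = \<sigma> (\<sigma> (\<sigma> grig_a)) (True # True # v)"
    "\<forall>v. (?u \<circ> ?u) (True # True # v) = \<sigma> (\<sigma> (\<sigma> grig_c)) (True # True # v)"
    "\<forall>v. ?v (True # True # v) = \<sigma> (\<sigma> (\<sigma> grig_d)) (True # True # v)"
    by (simp_all only: cube_True grig_gens_closed) (simp_all add: a c d grig_invol)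
  ultimately show ?thesis using assms by blast
qed

end

section \<open>Finite quotients\<close>

text \<open>Records a homomorphism from the HNN extension to a finite group by its restriction
  \<open>f\<close> to the base and the image \<open>T\<close> of the stable letter.\<close>

locale stable_finite_quotient = Lysenok_endomorphism + Q: group Q
  for Q :: "('q, 'm) monoid_scheme" (structure) +
  fixes f :: "(vertex \<Rightarrow> vertex) \<Rightarrow> 'q" and T :: 'q
  assumes fin: "finite (carrier Q)"
    and f_hom: "f \<in> hom Grigorchuk_commutator Q"
    and T: "T \<in> carrier Q"
    and conj: "x \<in> grig_derived \<Longrightarrow> T \<otimes> f x = f (\<sigma> x) \<otimes> T"
begin

lemma f_closed: "x \<in> grig_derived \<Longrightarrow> f x \<in> carrier Q"
  using f_hom by (auto simp: hom_def Grigorchuk_commutator_def)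

lemma f_comp:
  assumes "x \<in> grig_derived" "y \<in> grig_derived"
  shows "f (x \<circ> y) = f x \<otimes> f y"
  using hom_mult[OF f_hom, of x y] assms
  by (simp add: Grigorchuk_commutator_def Grigorchuk_mult grig_derived_carrier)

lemma f_id: "f id = \<one>"
  using hom_one[OF f_hom group_Grigorchuk_commutator Q.group_axioms]
  by (simp add: Grigorchuk_commutator_def Grigorchuk_one)

lemma funpow_derived: "x \<in> grig_derived \<Longrightarrow> (\<sigma> ^^ k) x \<in> grig_derived"
  by (induction k) (auto intro: derived_closed)

lemma conj_pow: "x \<in> grig_derived \<Longrightarrow> T [^] k \<otimes> f x = f ((\<sigma> ^^ k) x) \<otimes> T [^] (k::nat)"
  by (rule Q.nat_pow_intertwine[where A = grig_derived]) (auto simp: T f_closed derived_closed conj)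

text \<open>A large iterate of \<open>\<sigma>\<close> does not change \<open>f\<close> but moves all supports below the vertex 11, which
  the element \<open>acac\<close> of the commutator subgroup moves off itself.\<close>

lemma f_commute:
  assumes x: "x \<in> grig_derived" and y: "y \<in> grig_derived"
  shows "f x \<otimes> f y = f y \<otimes> f x"
proof -
  \<comment> \<open>A multiple of \<open>order Q\<close>, so that \<open>T^m = 1\<close>, and at
    least 3, so that \<open>cube_supported\<close> applies to the last three iterations.\<close>
  define m where "m = 3 * order Q"
  have "order Q > 0" using fin Q.order_gt_0_iff_finite by simp
  then obtain k where k: "m = 3 + k" unfolding m_def by (metis Suc_leI mult_le_mono2 nat_mult_1_right le_Suc_ex One_nat_def)
  have Tm: "T [^] m = \<one>"
    using Q.pow_order_eq_1[OF T] T Q.nat_pow_pow[OF T, of "order Q" 3] by (simp add: m_def mult.commute)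
  have *: "\<exists>z' \<in> grig_derived. supported_11 z' \<and> f z' = f z" if z: "z \<in> grig_derived" for z
  proof (intro bexI conjI)
    have "f ((\<sigma> ^^ m) z) = f z"
      using conj_pow[OF z, of m] Tm f_closed z funpow_derived by simp
    moreover have eq: "(\<sigma> ^^ m) z = \<sigma> (\<sigma> (\<sigma> ((\<sigma> ^^ k) z)))"
      by (simp add: k numeral_3_eq_3)
    ultimately show "f (\<sigma> (\<sigma> (\<sigma> ((\<sigma> ^^ k) z)))) = f z" by simp
  qed (use z in \<open>auto intro: cube_supported funpow_derived derived_closed\<close>)
  let ?u = "grig_a \<circ> grig_c \<circ> grig_a \<circ> grig_c"
  let ?U = "inv\<^bsub>Grigorchuk\<^esub> ?u"
  have u: "?u \<in> grig_derived" "?U \<in> grig_derived" "?u \<in> carrier Grigorchuk"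
    using grig_ac_derived grig_derived_inv grig_derived_carrier by blast+
  \<comment> \<open>Taking \<open>x'\<close> for the conjugate of \<open>x\<close> by the inverse of
    \<open>?u\<close> makes the conjugate of \<open>x'\<close> by \<open>?u\<close> have image
    \<open>f x\<close>.\<close>
  obtain x' where x': "x' \<in> grig_derived" "supported_11 x'" "f x' = f (?U \<circ> x \<circ> ?u)"
    using *[of "?U \<circ> x \<circ> ?u"] x u grig_derived_comp by blast
  obtain y' where y': "y' \<in> grig_derived" "supported_11 y'" "f y' = f y" using *[OF y] by blast
  \<comment> \<open>\<open>?u\<close> sends 11 to 10.\<close>
  have "?u (True # True # v) \<noteq> True # True # v'" for v v'
    by simp
  then have eq: "?u \<circ> x' \<circ> ?U \<circ> y' = y' \<circ> (?u \<circ> x' \<circ> ?U)"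
    using supported_11_conj_commute[OF u(3) x'(2) y'(2)] by blast
  have mem: "?u \<circ> x' \<circ> ?U \<in> grig_derived" using u x' grig_derived_comp by blast
  have "f (?u \<circ> x' \<circ> ?U) = f ?u \<otimes> f (?U \<circ> x \<circ> ?u) \<otimes> f ?U"
    using u x' grig_derived_comp by (simp add: f_comp)
  also have "\<dots> = f (?u \<circ> (?U \<circ> x \<circ> ?u) \<circ> ?U)"
    using u x grig_derived_comp by (simp only: f_comp)
  also have "?u \<circ> (?U \<circ> x \<circ> ?u) \<circ> ?U = x"
    using Grigorchuk_inv_apply[OF u(3)] by (simp add: fun_eq_iff)
  finally have "f (?u \<circ> x' \<circ> ?U) = f x" .
  then show ?thesis using arg_cong[OF eq, of f] f_comp[OF mem y'(1)] f_comp[OF y'(1) mem] y'(3) by simp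
qed

text \<open>After three applications of \<open>\<sigma>\<close>, conjugation by \<open>s\<close>
  becomes conjugation by some \<open>p\<close> in \<open>N\<close>, which is invisible because the
  image of \<open>f\<close> is abelian.\<close>

lemma f_gen_conj:
  assumes s: "s \<in> {grig_a, grig_c, grig_d}" and x: "x \<in> grig_derived"
  shows "f (s \<circ> x \<circ> inv\<^bsub>Grigorchuk\<^esub> s) = f x"
proof -
  have sG: "s \<in> carrier Grigorchuk" using s grig_gens_closed by auto
  have xG: "x \<in> carrier Grigorchuk" using x grig_derived_carrier by simp
  let ?y = "s \<circ> x \<circ> inv\<^bsub>Grigorchuk\<^esub> s"
  let ?S = "\<sigma> (\<sigma> (\<sigma> s))" and ?X = "\<sigma> (\<sigma> (\<sigma> x))"
  have y: "?y \<in> grig_derived" using grig_derived_conj[OF sG x] .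
  have X: "?X \<in> grig_derived" using x derived_closed by simp
  obtain p where p: "p \<in> grig_derived" "\<And>v. p (True # True # v) = ?S (True # True # v)"
    using cube_gen_derived[OF s] by blast
  have pG: "p \<in> carrier Grigorchuk" using p grig_derived_carrier by simp
  let ?p = "inv\<^bsub>Grigorchuk\<^esub> p"
  have P: "?p \<in> grig_derived" using p grig_derived_inv by simp
  have "\<sigma> (\<sigma> (\<sigma> ?y)) = ?S \<circ> ?X \<circ> inv\<^bsub>Grigorchuk\<^esub> ?S"
    using sG xG by (simp add: map_comp map_inv closed Grigorchuk_comp_closed Grigorchuk_inv_closed)
  also have "\<dots> = p \<circ> ?X \<circ> ?p"
    using supported_11_conj_cong[OF pG _ cube_supported[OF x], of ?S] p(2) sG closed by simp
  finally have "f (\<sigma> (\<sigma> (\<sigma> ?y))) = f ?X \<otimes> (f p \<otimes> f ?p)"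
    using p P X f_commute[OF p(1) X] by (simp add: f_comp grig_derived_comp f_closed Q.m_assoc)
  also have "f p \<otimes> f ?p = \<one>"
    using f_comp[OF p(1) P] f_id Grigorchuk_inv_apply[OF pG] by (simp add: comp_def id_def)
  finally have "f (\<sigma> (\<sigma> (\<sigma> ?y))) = f ?X" using X f_closed Q.r_one by metis
  \<comment> \<open>Both sides become \<open>f ?X \<otimes> T^3\<close>, and cancelling
    \<open>T^3\<close> undoes the three applications.\<close>
  then have "T [^] (3::nat) \<otimes> f ?y = T [^] (3::nat) \<otimes> f x"
    using conj_pow[OF x, of 3] conj_pow[OF y, of 3] by (simp add: numeral_3_eq_3)
  then show ?thesis using T f_closed x y by simp
qed

lemma f_conj:
  assumes "g \<in> carrier Grigorchuk" "x \<in> grig_derived"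
  shows "f (g \<circ> x \<circ> inv\<^bsub>Grigorchuk\<^esub> g) = f x"
  using assms(1)
proof (induction rule: Grigorchuk_induct)
  case id
  have "inv\<^bsub>Grigorchuk\<^esub> id = id" by (simp add: Grigorchuk_inv_unique Grigorchuk_id_closed)
  then have "id \<circ> x \<circ> inv\<^bsub>Grigorchuk\<^esub> id = x" by simp
  then show ?case by (rule arg_cong)
next
  case (step s g)
  have "s \<in> carrier Grigorchuk" using step grig_gens_closed by auto
  then have "s \<circ> g \<circ> x \<circ> inv\<^bsub>Grigorchuk\<^esub> (s \<circ> g)
      = s \<circ> (g \<circ> x \<circ> inv\<^bsub>Grigorchuk\<^esub> g) \<circ> inv\<^bsub>Grigorchuk\<^esub> s"
    using step Grigorchuk_inv_comp by (simp add: comp_assoc)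
  then show ?case
    using f_gen_conj[OF step(1) grig_derived_conj[OF step(2) assms(2)]] step(3) by metis
qed

text \<open>Invariance of \<open>f\<close> under conjugation by \<open>G\<close> removes the
  conjugator from \<open>[g g', h] = g [g', h] g^-1 [g, h]\<close>.\<close>

lemma f_commutator_left:
  assumes "g \<in> carrier Grigorchuk" "g' \<in> carrier Grigorchuk" "h \<in> carrier Grigorchuk"
  shows "f (grig_commutator (g \<circ> g') h) = f (grig_commutator g' h) \<otimes> f (grig_commutator g h)"
proof -
  have "grig_commutator (g \<circ> g') h
      = (g \<circ> grig_commutator g' h \<circ> inv\<^bsub>Grigorchuk\<^esub> g) \<circ> grig_commutator g h"
    using assms by (simp add: grig_commutator_def Grigorchuk_inv_comp fun_eq_iff Grigorchuk_inv_apply)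
  then show ?thesis
    using assms by (simp only: f_comp grig_derived_conj grig_commutator_derived f_conj)
qed

lemma f_commutator_right:
  assumes "g \<in> carrier Grigorchuk" "h \<in> carrier Grigorchuk" "h' \<in> carrier Grigorchuk"
  shows "f (grig_commutator g (h \<circ> h')) = f (grig_commutator g h) \<otimes> f (grig_commutator g h')"
proof -
  have "grig_commutator g (h \<circ> h')
      = grig_commutator g h \<circ> (h \<circ> grig_commutator g h' \<circ> inv\<^bsub>Grigorchuk\<^esub> h)"
    using assms by (simp add: grig_commutator_def Grigorchuk_inv_comp fun_eq_iff Grigorchuk_inv_apply)
  then show ?thesis
    using assms by (simp only: f_comp grig_derived_conj grig_commutator_derived f_conj)
qed

text \<open>If \<open>a\<close> inverts \<open>x\<close>, invariance under conjugation by
  \<open>a\<close> makes \<open>f x\<close> its own inverse.\<close>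

lemma f_sq_eq_one:
  assumes x: "x \<in> grig_derived" and inv: "grig_a \<circ> x \<circ> grig_a \<circ> x = id"
  shows "f x \<otimes> f x = \<one>"
proof -
  have y: "grig_a \<circ> x \<circ> grig_a \<in> grig_derived"
    using grig_derived_conj[of grig_a x] x by (simp add: grig_gens_closed grig_gens_inv)
  have "f (grig_a \<circ> x \<circ> grig_a) = f x"
    using f_conj[of grig_a x] x by (simp add: grig_gens_closed grig_gens_inv)
  then show ?thesis using f_comp[OF y x] inv f_id by simp
qed

lemma f_eq_one_if_stable:
  assumes "x \<in> grig_derived" "f (\<sigma> x) = \<one>"
  shows "f x = \<one>"
  using conj[OF assms(1)] assms T f_closed by simp

lemma f_ac: "f (grig_a \<circ> grig_c \<circ> grig_a \<circ> grig_c) = \<one>" (is "f ?u = _")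
proof -
  let ?w = "grig_d \<circ> ?u \<circ> grig_d"
  have w: "?w \<in> grig_derived" "f ?w = f ?u"
    using grig_derived_conj[of grig_d ?u] f_conj[of grig_d ?u] grig_ac_derived
    by (simp_all add: grig_gens_closed grig_gens_inv)
  have dc: "grig_d (grig_c v) = grig_b v" "grig_c (grig_d v) = grig_b v" for v
    by (simp_all add: grig_cd_eq_b)
  have cb: "grig_c (grig_b v) = grig_d v" for v
    using dc grig_invol by metis
  \<comment> \<open>With \<open>cd = b\<close>, the word \<open>acac d acac d\<close> regroups to
    \<open>aca b aca b\<close>.\<close>
  have "\<sigma> ?u = ?u \<circ> ?w"
    by (simp add: map_comp grig_gens_closed Grigorchuk_comp_closed a c fun_eq_iff grig_invol dc cb)
  then have "f (\<sigma> ?u) = f ?u \<otimes> f ?u" using f_comp[OF grig_ac_derived w(1)] w(2) by simp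
  also have "\<dots> = \<one>"
    \<comment> \<open>Conjugation by \<open>a\<close> turns \<open>acac\<close> into its inverse
      \<open>caca\<close>.\<close>
    using grig_ac_derived by (rule f_sq_eq_one) (simp add: fun_eq_iff grig_invol)
  finally show ?thesis using f_eq_one_if_stable grig_ac_derived by blast
qed

lemma f_ad: "f (grig_a \<circ> grig_d \<circ> grig_a \<circ> grig_d) = \<one>" (is "f ?v = _")
proof -
  let ?u = "grig_a \<circ> grig_c \<circ> grig_a \<circ> grig_c"
  have "\<sigma> ?v = ?u \<circ> ?u"
    by (simp add: map_comp grig_gens_closed Grigorchuk_comp_closed a d fun_eq_iff)
  then have "f (\<sigma> ?v) = \<one>"
    using f_comp[OF grig_ac_derived grig_ac_derived] f_ac by simp
  then show ?thesis using f_eq_one_if_stable grig_ad_derived by blast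
qed

text \<open>The pairs \<open>(a, c)\<close> and \<open>(a, d)\<close> are \<open>f_ac\<close> and
  \<open>f_ad\<close>; \<open>c\<close> and \<open>d\<close> commute, and exchanging the entries
  inverts a commutator.\<close>

lemma f_commutator_gens:
  assumes "s \<in> {grig_a, grig_c, grig_d}" "s' \<in> {grig_a, grig_c, grig_d}"
  shows "f (grig_commutator s s') = \<one>"
proof -
  have ac: "f (grig_commutator grig_a grig_c) = \<one>" and ad: "f (grig_commutator grig_a grig_d) = \<one>"
    using f_ac f_ad by (simp_all add: grig_commutator_def grig_gens_inv)
  have swap: "f (grig_commutator h g) = \<one>"
    if "f (grig_commutator g h) = \<one>" "g \<in> carrier Grigorchuk" "h \<in> carrier Grigorchuk" for g h
  proof -
    have "grig_commutator g h \<circ> grig_commutator h g = id"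
      using that by (simp add: grig_commutator_def fun_eq_iff Grigorchuk_inv_apply)
    then show ?thesis
      using that f_comp[of "grig_commutator g h" "grig_commutator h g"] f_id f_closed
        grig_commutator_derived by simp
  qed
  have "grig_commutator grig_c grig_d = id" "grig_commutator grig_d grig_c = id"
    "grig_commutator grig_a grig_a = id" "grig_commutator grig_c grig_c = id" "grig_commutator grig_d grig_d = id"
    by (auto simp: grig_commutator_def grig_gens_inv fun_eq_iff grig_invol grig_cd_eq_b)
  then show ?thesis using assms ac ad swap grig_gens_closed f_id by auto
qed

text \<open>It is enough to treat single commutators. Bimultiplicativity splits first the right
  entry, against a fixed generator, and then the left entry, down to commutators of
  generators.\<close>

lemma f_trivial: "x \<in> grig_derived \<Longrightarrow> f x = \<one>"
proof (induction rule: grig_derived_induct)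
  case id
  then show ?case by (rule f_id)
next
  case (step g h y)
  have idc: "grig_commutator id k = id" "grig_commutator k id = id"
    if "k \<in> carrier Grigorchuk" for k
  proof -
    have "inv\<^bsub>Grigorchuk\<^esub> id = id" by (simp add: Grigorchuk_inv_unique Grigorchuk_id_closed)
    then show "grig_commutator id k = id" "grig_commutator k id = id"
      using that by (simp_all add: grig_commutator_def fun_eq_iff Grigorchuk_inv_apply)
  qed
  have gen: "f (grig_commutator s h) = \<one>" if s: "s \<in> {grig_a, grig_c, grig_d}" for s
    using step(2)
  proof (induction rule: Grigorchuk_induct)
    case id
    have "s \<in> carrier Grigorchuk" using s grig_gens_closed by auto
    then show ?case using idc(2) f_id by metis
  next
    case (step s' h)
    have "s \<in> carrier Grigorchuk" "s' \<in> carrier Grigorchuk" using s step grig_gens_closed by auto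
    then have "f (grig_commutator s (s' \<circ> h)) = \<one>"
      using f_commutator_right step f_commutator_gens s by simp
    then show ?case .
  qed
  have "f (grig_commutator g h) = \<one>"
    using step(1)
  proof (induction rule: Grigorchuk_induct)
    case id
    show ?case unfolding idc(1)[OF step(2)] by (rule f_id)
  next
    case (step s g)
    have "s \<in> carrier Grigorchuk" using step grig_gens_closed by auto
    then have "f (grig_commutator (s \<circ> g) h) = \<one>"
      using f_commutator_left step \<open>h \<in> carrier Grigorchuk\<close> gen by simp
    then show ?case .
  qed
  then have "f (grig_commutator g h \<circ> y) = \<one>"
    using step f_comp grig_commutator_derived by simp
  then show ?case .
qed

end

section \<open>The action on right cosets\<close>

text \<open>The inverse turns right multiplication into a left action, giving a homomorphism to the
  permutations; the bounded lambda meets the extensionality demanded by \<open>Bij\<close>.\<close>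

definition (in group) rcoset_action :: "'a set \<Rightarrow> 'a \<Rightarrow> 'a set \<Rightarrow> 'a set" where
  "rcoset_action H g = (\<lambda>R \<in> rcosets H. R #> inv g)"

lemma (in group) rcosets_mult_closed:
  assumes "subgroup H G" "R \<in> rcosets H" "g \<in> carrier G"
  shows "R #> g \<in> rcosets H"
proof -
  have H: "H \<subseteq> carrier G" using assms(1) by (rule subgroup.subset)
  obtain x where "x \<in> carrier G" "R = H #> x" using assms(2) by (auto simp: RCOSETS_def)
  then show ?thesis using H assms(3) by (simp add: coset_mult_assoc rcosetsI)
qed

lemma (in group) rcoset_action_Bij:
  assumes H: "subgroup H G" and g: "g \<in> carrier G"
  shows "rcoset_action H g \<in> Bij (rcosets H)"
proof -
  have sub: "R \<subseteq> carrier G" if "R \<in> rcosets H" for R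
    using rcosets_part_G[OF H] that by auto
  have "bij_betw (rcoset_action H g) (rcosets H) (rcosets H)"
    by (rule bij_betw_byWitness[where f' = "\<lambda>R. R #> g"])
       (use H g sub in \<open>auto simp: rcoset_action_def coset_mult_assoc rcosets_mult_closed\<close>)
  then show ?thesis by (simp add: Bij_def rcoset_action_def)
qed

lemma (in group) rcoset_action_hom:
  assumes H: "subgroup H G"
  shows "rcoset_action H \<in> hom G (BijGroup (rcosets H))"
proof (rule homI)
  fix g h assume gh: "g \<in> carrier G" "h \<in> carrier G"
  have sub: "R \<subseteq> carrier G" if "R \<in> rcosets H" for R
    using rcosets_part_G[OF H] that by auto
  have "rcoset_action H (g \<otimes> h) = compose (rcosets H) (rcoset_action H g) (rcoset_action H h)"
    using gh sub H
    by (auto simp: rcoset_action_def compose_def restrict_def fun_eq_iff coset_mult_assoc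
        inv_mult_group rcosets_mult_closed)
  then show "rcoset_action H (g \<otimes> h) = rcoset_action H g \<otimes>\<^bsub>BijGroup (rcosets H)\<^esub> rcoset_action H h"
    using rcoset_action_Bij[OF H] gh by (simp add: BijGroup_def)
qed (simp add: BijGroup_def rcoset_action_Bij[OF H])

text \<open>Evaluate the trivial action at the coset \<open>H\<close> itself.\<close>

lemma (in group) rcoset_action_kernel:
  assumes H: "subgroup H G" and g: "g \<in> carrier G"
    and one: "rcoset_action H g = \<one>\<^bsub>BijGroup (rcosets H)\<^esub>"
  shows "g \<in> H"
proof -
  have "H \<in> rcosets H" using rcosetsI[OF subgroup.subset[OF H] one_closed] coset_mult_one[OF subgroup.subset[OF H]] by simp
  then have "H #> inv g = H"
    using fun_cong[OF one, of H] by (simp add: rcoset_action_def BijGroup_def)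
  then have "inv g \<in> H" using coset_join1 g H by simp
  then have "inv (inv g) \<in> H" using subgroup.m_inv_closed[OF H] by blast
  then show ?thesis using g by simp
qed

lemma finite_BijGroup:
  assumes "finite S"
  shows "finite (carrier (BijGroup S))"
proof (rule finite_subset)
  show "carrier (BijGroup S) \<subseteq> S \<rightarrow>\<^sub>E S"
    by (auto simp: BijGroup_def PiE_def Bij_imp_extensional dest: Bij_imp_funcset)
qed (use assms in \<open>simp add: finite_PiE\<close>)

section \<open>Finite index subgroups containing the base of an ascending HNN extension\<close>

locale ascending_hnn_extension = N: group N
  for N :: "('a, 'm) monoid_scheme" and \<theta> :: "'a \<Rightarrow> 'a" +
  assumes maps: "x \<in> carrier N \<Longrightarrow> \<theta> x \<in> carrier N"
begin

abbreviation "\<Delta> \<equiv> ascending_hnn N \<theta>"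
abbreviation "cls \<equiv> pres_class (hnn_gens N) (hnn_relators N \<theta>)"
abbreviation "\<beta> \<equiv> hnn_base N \<theta>"
abbreviation "t \<equiv> hnn_stable N \<theta>"

sublocale D: group \<Delta>
  by (rule group_ascending_hnn)

section \<open>Words and relations in the HNN extension\<close>

lemma gwords_simps:
  "[] \<in> gwords (hnn_gens N)"
  "(g, e) # w \<in> gwords (hnn_gens N) \<longleftrightarrow> g \<in> hnn_gens N \<and> w \<in> gwords (hnn_gens N)"
  "v @ w \<in> gwords (hnn_gens N) \<longleftrightarrow> v \<in> gwords (hnn_gens N) \<and> w \<in> gwords (hnn_gens N)"
  "Stable \<in> hnn_gens N" "Base x \<in> hnn_gens N \<longleftrightarrow> x \<in> carrier N"
  by (auto simp: gwords_def hnn_gens_def)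

lemma carrier_iff: "X \<in> carrier \<Delta> \<longleftrightarrow> (\<exists>w \<in> gwords (hnn_gens N). X = cls w)"
  by (auto simp: ascending_hnn_def presented_group_def quotient_def pres_class_def)

lemma cls_mult:
  "v \<in> gwords (hnn_gens N) \<Longrightarrow> w \<in> gwords (hnn_gens N) \<Longrightarrow> cls v \<otimes>\<^bsub>\<Delta>\<^esub> cls w = cls (v @ w)"
  by (simp add: ascending_hnn_def pres_class_mult)

lemma cls_one: "\<one>\<^bsub>\<Delta>\<^esub> = cls []"
  by (simp add: ascending_hnn_def presented_group_def)

lemma cls_cancel:
  assumes "u \<in> gwords (hnn_gens N)" "v \<in> gwords (hnn_gens N)" "g \<in> hnn_gens N"
  shows "cls (u @ [(g, e), (g, \<not> e)] @ v) = cls (u @ v)"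
  unfolding pres_class_def
  by (rule equiv_class_eq[OF equiv_pres_rel]) (rule pres_rel.cancel[OF assms])

lemma cls_relator:
  assumes "r \<in> hnn_relators N \<theta>" "r \<in> gwords (hnn_gens N)" "v \<in> gwords (hnn_gens N)"
  shows "cls (r @ v) = cls v"
  unfolding pres_class_def
  by (rule equiv_class_eq[OF equiv_pres_rel])
     (use pres_rel.relator[of "[]" "hnn_gens N" v r "hnn_relators N \<theta>"] assms in
       \<open>simp add: gwords_simps\<close>)

lemma base_closed: "x \<in> carrier N \<Longrightarrow> \<beta> x \<in> carrier \<Delta>"
  by (auto simp: carrier_iff hnn_base_def gwords_simps intro!: bexI[of _ "[(Base x, True)]"])

lemma stable_closed: "t \<in> carrier \<Delta>"
  by (auto simp: carrier_iff hnn_stable_def gwords_simps intro!: bexI[of _ "[(Stable, True)]"])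

lemma base_hom: "\<beta> \<in> hom N \<Delta>"
proof (rule homI)
  fix x y assume xy: "x \<in> carrier N" "y \<in> carrier N"
  let ?z = "Base (x \<otimes>\<^bsub>N\<^esub> y)"
  have "\<beta> x \<otimes>\<^bsub>\<Delta>\<^esub> \<beta> y = cls [(Base x, True), (Base y, True)]"
    using xy by (simp add: hnn_base_def cls_mult gwords_simps)
  \<comment> \<open>Inserting \<open>z^-1 z\<close> completes a multiplication table relator as a
    prefix.\<close>
  also have "\<dots> = cls ([(Base x, True), (Base y, True), (?z, False)] @ [(?z, True)])"
    using cls_cancel[of "[(Base x, True), (Base y, True)]" "[]" ?z False] xy
    by (simp add: gwords_simps)
  also have "\<dots> = \<beta> (x \<otimes>\<^bsub>N\<^esub> y)"
    unfolding hnn_base_def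
    by (rule cls_relator) (use xy in \<open>auto simp: hnn_relators_def gwords_simps\<close>)
  finally show "\<beta> (x \<otimes>\<^bsub>N\<^esub> y) = \<beta> x \<otimes>\<^bsub>\<Delta>\<^esub> \<beta> y" by simp
qed (rule base_closed)

lemma stable_conj:
  assumes x: "x \<in> carrier N"
  shows "t \<otimes>\<^bsub>\<Delta>\<^esub> \<beta> x = \<beta> (\<theta> x) \<otimes>\<^bsub>\<Delta>\<^esub> t"
proof -
  let ?y = "Base (\<theta> x)"
  let ?u = "[(Stable, True), (Base x, True)]"
  note g = gwords_simps x maps[OF x]
  have "t \<otimes>\<^bsub>\<Delta>\<^esub> \<beta> x = cls ?u"
    by (simp add: hnn_base_def hnn_stable_def cls_mult g)
  \<comment> \<open>Inserting \<open>t^-1 t\<close> and then \<open>y^-1 y\<close>, with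
    \<open>y = \<theta> x\<close>, completes the relator \<open>t x t^-1 y^-1\<close> as a
    prefix.\<close>
  also have "\<dots> = cls (?u @ [(Stable, False), (Stable, True)])"
    using cls_cancel[of ?u "[]" Stable False] by (simp add: g)
  also have "\<dots> = cls ((?u @ [(Stable, False), (?y, False)]) @ [(?y, True), (Stable, True)])"
    using cls_cancel[of "?u @ [(Stable, False)]" "[(Stable, True)]" ?y False] by (simp add: g)
  also have "\<dots> = cls [(?y, True), (Stable, True)]"
    by (rule cls_relator) (use x in \<open>auto simp: hnn_relators_def g\<close>)
  also have "\<dots> = \<beta> (\<theta> x) \<otimes>\<^bsub>\<Delta>\<^esub> t"
    by (simp add: hnn_base_def hnn_stable_def cls_mult g)
  finally show ?thesis .
qed

lemma cls_inverse_letter: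
  assumes "g \<in> hnn_gens N"
  shows "cls [(g, False)] = inv\<^bsub>\<Delta>\<^esub> cls [(g, True)]"
proof (rule D.inv_equality[symmetric])
  show "cls [(g, False)] \<otimes>\<^bsub>\<Delta>\<^esub> cls [(g, True)] = \<one>\<^bsub>\<Delta>\<^esub>"
    using cls_cancel[of "[]" "[]" g False] assms by (simp add: cls_mult cls_one gwords_simps)
qed (use assms in \<open>auto simp: carrier_iff gwords_simps\<close>)

text \<open>Letters are appended on the right, to suit right coset representatives. Inverse base
  letters are again base letters, so only \<open>t\<close> has a separate inverse case.\<close>

lemma hnn_induct [consumes 1, case_names one base stable inv_stable]:
  assumes X: "X \<in> carrier \<Delta>"
    and one: "P \<one>\<^bsub>\<Delta>\<^esub>"
    and base: "\<And>Y x. Y \<in> carrier \<Delta> \<Longrightarrow> x \<in> carrier N \<Longrightarrow> P Y \<Longrightarrow> P (Y \<otimes>\<^bsub>\<Delta>\<^esub> \<beta> x)"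
    and stable: "\<And>Y. Y \<in> carrier \<Delta> \<Longrightarrow> P Y \<Longrightarrow> P (Y \<otimes>\<^bsub>\<Delta>\<^esub> t)"
    and inv_stable: "\<And>Y. Y \<in> carrier \<Delta> \<Longrightarrow> P Y \<Longrightarrow> P (Y \<otimes>\<^bsub>\<Delta>\<^esub> inv\<^bsub>\<Delta>\<^esub> t)"
  shows "P X"
proof -
  obtain w where w: "w \<in> gwords (hnn_gens N)" "X = cls w" using X carrier_iff by blast
  have "P (cls w)" using w(1)
  proof (induction w rule: rev_induct)
    case Nil
    then show ?case using one by (simp add: cls_one)
  next
    case (snoc l w)
    obtain g e where l: "l = (g, e)" by (cases l)
    have w: "w \<in> gwords (hnn_gens N)" "g \<in> hnn_gens N" and "P (cls w)"
      using snoc by (simp_all add: l gwords_simps)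
    moreover have "cls w \<in> carrier \<Delta>" using w carrier_iff by blast
    moreover have "cls (w @ [l]) = cls w \<otimes>\<^bsub>\<Delta>\<^esub> cls [(g, e)]"
      using w by (simp add: cls_mult gwords_simps l)
    moreover have "cls [(g, e)] \<in> insert t (insert (inv\<^bsub>\<Delta>\<^esub> t) (\<beta> ` carrier N))"
    proof (cases g)
      case (Base x)
      then have x: "x \<in> carrier N" using w by (simp add: gwords_simps)
      have "inv\<^bsub>\<Delta>\<^esub> \<beta> x = \<beta> (inv\<^bsub>N\<^esub> x)"
        using group_hom.hom_inv[OF group_hom.intro[OF N.group_axioms D.group_axioms]] base_hom x
        by (simp add: group_hom_axioms_def)
      then show ?thesis
        using Base w x cls_inverse_letter[of g] by (cases e) (auto simp: hnn_base_def)
    next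
      case Stable
      then show ?thesis
        using w cls_inverse_letter[of g] by (cases e) (auto simp: hnn_stable_def)
    qed
    ultimately show ?case using base stable inv_stable by auto
  qed
  then show ?thesis using w by simp
qed

section \<open>Powers of the stable letter as coset representatives\<close>

lemma stable_pow_closed: "t [^]\<^bsub>\<Delta>\<^esub> (k::nat) \<in> carrier \<Delta>"
  by (simp add: stable_closed)

text \<open>Base elements move left past \<open>t^i\<close> by
  \<open>t^i x = \<theta>^i(x) t^i\<close> and are absorbed into \<open>H\<close>. Multiplying by
  \<open>t\<close> or its inverse changes \<open>i\<close>, and \<open>t^n\<close> in
  \<open>H\<close> keeps the exponent nonnegative and finally below \<open>n\<close>.\<close>

lemma coset_representative:
  assumes H: "subgroup H \<Delta>" and base: "\<beta> ` carrier N \<subseteq> H"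
    and n: "n \<ge> (1::nat)" "t [^]\<^bsub>\<Delta>\<^esub> n \<in> H" and X: "X \<in> carrier \<Delta>"
  shows "\<exists>i<n. \<exists>h\<in>H. X = h \<otimes>\<^bsub>\<Delta>\<^esub> t [^]\<^bsub>\<Delta>\<^esub> i"
proof -
  note mem = subgroup.mem_carrier[OF H]
  have "\<exists>i::nat. \<exists>h\<in>H. X = h \<otimes>\<^bsub>\<Delta>\<^esub> t [^]\<^bsub>\<Delta>\<^esub> i"
    using X
  proof (induction rule: hnn_induct)
    case one
    show ?case
      using subgroup.one_closed[OF H] by (intro exI[of _ 0] bexI[of _ "\<one>\<^bsub>\<Delta>\<^esub>"]) auto
  next
    case (base Y x)
    then obtain i h where h: "h \<in> H" "Y = h \<otimes>\<^bsub>\<Delta>\<^esub> t [^]\<^bsub>\<Delta>\<^esub> (i::nat)" by blast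
    let ?y = "(\<theta> ^^ i) x"
    have y: "?y \<in> carrier N" by (induction i) (auto simp: base maps)
    have "t [^]\<^bsub>\<Delta>\<^esub> i \<otimes>\<^bsub>\<Delta>\<^esub> \<beta> x = \<beta> ?y \<otimes>\<^bsub>\<Delta>\<^esub> t [^]\<^bsub>\<Delta>\<^esub> i"
      by (rule D.nat_pow_intertwine[where A = "carrier N"])
         (auto simp: stable_closed base_closed maps stable_conj base)
    then have "Y \<otimes>\<^bsub>\<Delta>\<^esub> \<beta> x = (h \<otimes>\<^bsub>\<Delta>\<^esub> \<beta> ?y) \<otimes>\<^bsub>\<Delta>\<^esub> t [^]\<^bsub>\<Delta>\<^esub> i"
      using h mem base y by (simp add: D.m_assoc base_closed stable_pow_closed)
    moreover have "h \<otimes>\<^bsub>\<Delta>\<^esub> \<beta> ?y \<in> H"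
      using h(1) y assms(2) subgroup.m_closed[OF H] by blast
    ultimately show ?case by blast
  next
    case (stable Y)
    then obtain i h where h: "h \<in> H" "Y = h \<otimes>\<^bsub>\<Delta>\<^esub> t [^]\<^bsub>\<Delta>\<^esub> (i::nat)" by blast
    then have "Y \<otimes>\<^bsub>\<Delta>\<^esub> t = h \<otimes>\<^bsub>\<Delta>\<^esub> t [^]\<^bsub>\<Delta>\<^esub> Suc i"
      using mem stable_closed by (simp add: D.m_assoc)
    then show ?case using h by blast
  next
    case (inv_stable Y)
    then obtain i h where h: "h \<in> H" "Y = h \<otimes>\<^bsub>\<Delta>\<^esub> t [^]\<^bsub>\<Delta>\<^esub> (i::nat)" by blast
    have red: "t [^]\<^bsub>\<Delta>\<^esub> Suc k \<otimes>\<^bsub>\<Delta>\<^esub> inv\<^bsub>\<Delta>\<^esub> t = t [^]\<^bsub>\<Delta>\<^esub> k" for k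
      using stable_closed by (simp add: D.m_assoc)
    show ?case
    proof (cases i)
      case 0
      \<comment> \<open>No power is left to lower, so \<open>t^-1\<close> is written as
        \<open>t^-n t^(n-1)\<close>, with \<open>t^-n\<close> absorbed into
        \<open>H\<close>.\<close>
      obtain m where m: "n = Suc m" using n(1) by (cases n) auto
      let ?s = "t [^]\<^bsub>\<Delta>\<^esub> n"
      have "Y \<otimes>\<^bsub>\<Delta>\<^esub> inv\<^bsub>\<Delta>\<^esub> t = h \<otimes>\<^bsub>\<Delta>\<^esub> (inv\<^bsub>\<Delta>\<^esub> ?s \<otimes>\<^bsub>\<Delta>\<^esub> ?s) \<otimes>\<^bsub>\<Delta>\<^esub> inv\<^bsub>\<Delta>\<^esub> t"
        using h 0 mem stable_pow_closed[of n] by simp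
      also have "\<dots> = (h \<otimes>\<^bsub>\<Delta>\<^esub> inv\<^bsub>\<Delta>\<^esub> ?s) \<otimes>\<^bsub>\<Delta>\<^esub> (?s \<otimes>\<^bsub>\<Delta>\<^esub> inv\<^bsub>\<Delta>\<^esub> t)"
        using h mem stable_pow_closed[of n] stable_closed by (simp only: D.m_assoc D.inv_closed D.m_closed)
      also have "\<dots> = (h \<otimes>\<^bsub>\<Delta>\<^esub> inv\<^bsub>\<Delta>\<^esub> ?s) \<otimes>\<^bsub>\<Delta>\<^esub> t [^]\<^bsub>\<Delta>\<^esub> m"
        using red[of m] m by simp
      finally show ?thesis
        using h(1) n(2) subgroup.m_closed[OF H] subgroup.m_inv_closed[OF H] by blast
    next
      case (Suc k)
      have "Y \<otimes>\<^bsub>\<Delta>\<^esub> inv\<^bsub>\<Delta>\<^esub> t = h \<otimes>\<^bsub>\<Delta>\<^esub> (t [^]\<^bsub>\<Delta>\<^esub> Suc k \<otimes>\<^bsub>\<Delta>\<^esub> inv\<^bsub>\<Delta>\<^esub> t)"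
        using h Suc mem stable_closed stable_pow_closed[of "Suc k"] by (simp only: D.m_assoc D.inv_closed)
      then show ?thesis using h(1) red by auto
    qed
  qed
  then obtain i h where h: "h \<in> H" "X = h \<otimes>\<^bsub>\<Delta>\<^esub> t [^]\<^bsub>\<Delta>\<^esub> (i::nat)" by blast
  \<comment> \<open>Division with remainder: \<open>?s\<close> is a power of \<open>t^n\<close> and
    so lies in \<open>H\<close>.\<close>
  let ?s = "(t [^]\<^bsub>\<Delta>\<^esub> n) [^]\<^bsub>\<Delta>\<^esub> (i div n)"
  have "t [^]\<^bsub>\<Delta>\<^esub> i = ?s \<otimes>\<^bsub>\<Delta>\<^esub> t [^]\<^bsub>\<Delta>\<^esub> (i mod n)"
    by (simp add: D.nat_pow_pow D.nat_pow_mult stable_closed)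
  then have "X = (h \<otimes>\<^bsub>\<Delta>\<^esub> ?s) \<otimes>\<^bsub>\<Delta>\<^esub> t [^]\<^bsub>\<Delta>\<^esub> (i mod n)"
    using h mem stable_closed by (simp add: D.m_assoc)
  moreover have "(t [^]\<^bsub>\<Delta>\<^esub> n) [^]\<^bsub>\<Delta>\<^esub> k \<in> H" for k :: nat
    by (induction k) (auto simp: subgroup.one_closed[OF H] subgroup.m_closed[OF H] n)
  ultimately show ?thesis
    using h(1) subgroup.m_closed[OF H] n(1) by (intro exI[of _ "i mod n"]) auto
qed

section \<open>Cyclic covers and the finite index subgroups containing the base\<close>

lemma cyclic_cover_gens: "\<beta> ` carrier N \<union> {t [^]\<^bsub>\<Delta>\<^esub> (n::nat)} \<subseteq> carrier \<Delta>"
  using base_closed stable_closed by auto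

lemma subgroup_cyclic_cover: "subgroup (cyclic_cover N \<theta> n) \<Delta>"
  unfolding cyclic_cover_def by (rule D.generate_is_subgroup[OF cyclic_cover_gens])

lemma base_cyclic_cover: "\<beta> ` carrier N \<subseteq> cyclic_cover N \<theta> n"
  unfolding cyclic_cover_def by (auto intro: generate.incl)

lemma stable_cyclic_cover: "t [^]\<^bsub>\<Delta>\<^esub> n \<in> cyclic_cover N \<theta> n"
  unfolding cyclic_cover_def by (auto intro: generate.incl)

lemma finite_rcosets_cyclic_cover:
  assumes n: "n \<ge> 1"
  shows "finite (rcosets\<^bsub>\<Delta>\<^esub> cyclic_cover N \<theta> n)"
proof (rule finite_subset)
  let ?C = "cyclic_cover N \<theta> n"
  show "rcosets\<^bsub>\<Delta>\<^esub> ?C \<subseteq> (\<lambda>i. ?C #>\<^bsub>\<Delta>\<^esub> t [^]\<^bsub>\<Delta>\<^esub> i) ` {..<n}"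
  proof
    fix R assume "R \<in> rcosets\<^bsub>\<Delta>\<^esub> ?C"
    then obtain X where X: "X \<in> carrier \<Delta>" "R = ?C #>\<^bsub>\<Delta>\<^esub> X" by (auto simp: RCOSETS_def)
    obtain i h where i: "i < n" "h \<in> ?C" "X = h \<otimes>\<^bsub>\<Delta>\<^esub> t [^]\<^bsub>\<Delta>\<^esub> i"
      using coset_representative[OF subgroup_cyclic_cover base_cyclic_cover n stable_cyclic_cover X(1)]
      by blast
    have "X \<in> ?C #>\<^bsub>\<Delta>\<^esub> t [^]\<^bsub>\<Delta>\<^esub> i" using i by (auto simp: r_coset_def)
    then have "R = ?C #>\<^bsub>\<Delta>\<^esub> t [^]\<^bsub>\<Delta>\<^esub> i"
      using D.repr_independence[OF _ stable_pow_closed subgroup_cyclic_cover] X(2) by simp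
    then show "R \<in> (\<lambda>i. ?C #>\<^bsub>\<Delta>\<^esub> t [^]\<^bsub>\<Delta>\<^esub> i) ` {..<n}" using i(1) by blast
  qed
qed simp

text \<open>Take the least positive \<open>n\<close> with \<open>t^n\<close> in \<open>H\<close>; a
  smaller remainder exponent of an element of \<open>H\<close> must then vanish.\<close>

lemma eq_cyclic_cover:
  assumes H: "subgroup H \<Delta>" and base: "\<beta> ` carrier N \<subseteq> H"
    and m: "m \<ge> 1" "t [^]\<^bsub>\<Delta>\<^esub> (m::nat) \<in> H"
  shows "\<exists>n\<ge>1. H = cyclic_cover N \<theta> n"
proof -
  define n where "n = (LEAST k. k \<ge> 1 \<and> t [^]\<^bsub>\<Delta>\<^esub> (k::nat) \<in> H)"
  have n: "n \<ge> 1" "t [^]\<^bsub>\<Delta>\<^esub> n \<in> H"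
    using LeastI[of "\<lambda>k. k \<ge> 1 \<and> t [^]\<^bsub>\<Delta>\<^esub> (k::nat) \<in> H" m] m by (simp_all add: n_def)
  have least: "k = 0" if "k < n" "t [^]\<^bsub>\<Delta>\<^esub> k \<in> H" for k
    using not_less_Least[of k "\<lambda>k. k \<ge> 1 \<and> t [^]\<^bsub>\<Delta>\<^esub> (k::nat) \<in> H"] that by (auto simp: n_def)
  let ?C = "cyclic_cover N \<theta> n"
  have CH: "?C \<subseteq> H"
    unfolding cyclic_cover_def using base n by (intro D.generate_subgroup_incl[OF _ H]) auto
  have "H \<subseteq> ?C"
  proof
    fix X assume X: "X \<in> H"
    \<comment> \<open>The representative is taken modulo \<open>?C\<close>, not \<open>H\<close>, so
      that \<open>i = 0\<close> puts \<open>X\<close> in \<open>?C\<close>.\<close>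
    obtain i h where i: "i < n" "h \<in> ?C" "X = h \<otimes>\<^bsub>\<Delta>\<^esub> t [^]\<^bsub>\<Delta>\<^esub> i"
      using coset_representative[OF subgroup_cyclic_cover base_cyclic_cover n(1) stable_cyclic_cover]
        subgroup.mem_carrier[OF H X] by blast
    have hc: "h \<in> carrier \<Delta>" using i(2) CH subgroup.mem_carrier[OF H] by blast
    have "t [^]\<^bsub>\<Delta>\<^esub> i = inv\<^bsub>\<Delta>\<^esub> h \<otimes>\<^bsub>\<Delta>\<^esub> X"
      using i(3) hc stable_pow_closed[of i] by (simp add: D.m_assoc[symmetric])
    then have "t [^]\<^bsub>\<Delta>\<^esub> i \<in> H"
      using i(2) CH X subgroup.m_closed[OF H] subgroup.m_inv_closed[OF H] by auto
    then have "i = 0" using least i(1) by blast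
    then show "X \<in> ?C" using i hc by simp
  qed
  then show ?thesis using CH n(1) by blast
qed

end

section \<open>Passage from finite index subgroups to finite quotients\<close>

theorem proposition6p4:
  fixes \<sigma> :: "(vertex \<Rightarrow> vertex) \<Rightarrow> (vertex \<Rightarrow> vertex)"
    and \<theta> :: "(vertex \<Rightarrow> vertex) \<Rightarrow> (vertex \<Rightarrow> vertex)"
    and \<Delta> :: "(vertex \<Rightarrow> vertex) hnn_gen gword set monoid"
  assumes "\<sigma> \<in> hom Grigorchuk Grigorchuk"
    and "inj_on \<sigma> (carrier Grigorchuk)"
    and "\<sigma> grig_a = grig_a \<otimes>\<^bsub>Grigorchuk\<^esub> grig_c \<otimes>\<^bsub>Grigorchuk\<^esub> grig_a"
    and "\<sigma> grig_c = grig_d \<otimes>\<^bsub>Grigorchuk\<^esub> grig_c"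
    and "\<sigma> grig_d = grig_c"
    and "\<theta> = restrict \<sigma> (carrier Grigorchuk_commutator)"
    and "\<Delta> = ascending_hnn Grigorchuk_commutator \<theta>"
  shows "{H. subgroup H \<Delta> \<and> finite (rcosets\<^bsub>\<Delta>\<^esub> H)}
       = {cyclic_cover Grigorchuk_commutator \<theta> n | n. n \<ge> 1}"
proof -
  let ?N = Grigorchuk_commutator
  have N: "carrier ?N = grig_derived"
    by (simp add: Grigorchuk_commutator_def)
  interpret L: Lysenok_endomorphism \<sigma>
  proof
    have "grig_d \<circ> grig_c = grig_b" by (auto simp: grig_cd_eq_b)
    then show "\<sigma> grig_c = grig_b" using assms(4) by (simp add: Grigorchuk_mult grig_gens_closed)
  qed (use assms in \<open>simp_all add: Grigorchuk_mult Grigorchuk_comp_closed grig_gens_closed\<close>)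
  have \<theta>: "\<theta> x = \<sigma> x" if "x \<in> grig_derived" for x
    using that assms(6) N by simp
  interpret E: ascending_hnn_extension ?N \<theta>
    using group_Grigorchuk_commutator L.derived_closed \<theta> N
    by (simp add: ascending_hnn_extension_def ascending_hnn_extension_axioms_def)
  have "\<exists>n\<ge>1. H = cyclic_cover ?N \<theta> n" if H: "subgroup H \<Delta>" and fin: "finite (rcosets\<^bsub>\<Delta>\<^esub> H)" for H
  proof -
    \<comment> \<open>Finite index makes the permutation group of the cosets finite; the action
      restricted to the base and the image of \<open>t\<close> are the data of
      \<open>stable_finite_quotient\<close>.\<close>
    let ?Q = "BijGroup (rcosets\<^bsub>\<Delta>\<^esub> H)"
    let ?\<phi> = "group.rcoset_action \<Delta> H"
    let ?t = "hnn_stable ?N \<theta>"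
    interpret \<phi>: group_hom \<Delta> ?Q ?\<phi>
      using E.D.rcoset_action_hom H assms(7) E.D.group_axioms group_BijGroup
      by (simp add: group_hom_def group_hom_axioms_def)
    have finQ: "finite (carrier ?Q)" using fin by (rule finite_BijGroup)
    note closed = E.base_closed E.stable_closed
    note kernel = group.rcoset_action_kernel[OF \<phi>.G.group_axioms H]
    interpret F: stable_finite_quotient \<sigma> ?Q "?\<phi> \<circ> hnn_base ?N \<theta>" "?\<phi> ?t"
    proof
      show "?\<phi> \<circ> hnn_base ?N \<theta> \<in> hom ?N ?Q"
        using hom_compose[OF E.base_hom] \<phi>.homh assms(7) by simp
      show "?\<phi> ?t \<in> carrier ?Q" using \<phi>.hom_closed closed assms(7) by simp
      fix x assume x: "x \<in> grig_derived"
      then have "?\<phi> (?t \<otimes>\<^bsub>\<Delta>\<^esub> hnn_base ?N \<theta> x) = ?\<phi> (hnn_base ?N \<theta> (\<sigma> x) \<otimes>\<^bsub>\<Delta>\<^esub> ?t)"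
        using E.stable_conj[of x] \<theta> N assms(7) by simp
      then show "?\<phi> ?t \<otimes>\<^bsub>?Q\<^esub> (?\<phi> \<circ> hnn_base ?N \<theta>) x = (?\<phi> \<circ> hnn_base ?N \<theta>) (\<sigma> x) \<otimes>\<^bsub>?Q\<^esub> ?\<phi> ?t"
        using \<phi>.hom_mult[of ?t] \<phi>.hom_mult[of _ ?t] x closed L.derived_closed N assms(7) by simp
    qed (rule finQ)
    \<comment> \<open>The base acts trivially on the cosets, hence lies in \<open>H\<close>.\<close>
    have "hnn_base ?N \<theta> ` carrier ?N \<subseteq> H"
      using F.f_trivial kernel closed N assms(7) by auto
    \<comment> \<open>The order of the finite group gives a positive power of \<open>t\<close>
      acting trivially.\<close>
    moreover have "?t [^]\<^bsub>\<Delta>\<^esub> order ?Q \<in> H"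
    proof (rule kernel)
      show "?\<phi> (?t [^]\<^bsub>\<Delta>\<^esub> order ?Q) = \<one>\<^bsub>?Q\<^esub>"
        using \<phi>.hom_nat_pow \<phi>.H.pow_order_eq_1[OF F.T] closed assms(7) by simp
    qed (use closed assms(7) in simp)
    moreover have "order ?Q \<ge> 1"
      using finQ \<phi>.H.order_gt_0_iff_finite by (simp add: Suc_le_eq)
    ultimately show ?thesis using E.eq_cyclic_cover H assms(7) by blast
  qed
  \<comment> \<open>Converse inclusion: each cyclic cover with \<open>n \<ge> 1\<close> is a
    subgroup of finite index.\<close>
  moreover have "subgroup (cyclic_cover ?N \<theta> n) \<Delta>" for n
    using E.subgroup_cyclic_cover assms(7) by simp
  moreover have "finite (rcosets\<^bsub>\<Delta>\<^esub> cyclic_cover ?N \<theta> n)" if "n \<ge> 1" for n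
    using E.finite_rcosets_cyclic_cover that assms(7) by simp
  ultimately show ?thesis by blast
qed

end
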